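(* Each of the following two decision problems can be transformed in linear time to the other one: (1) Is an (affine) tropical polyhedron empty? (2) Is a prescribed initial state in a mean payoff game winning?
   Context: Write $[n]=\{1,\dots,n\}$. Problem (1): the input is a pair of $m\times n$ matrices $A,B$ with entries in $\mathbb{R}\cup\{-\infty\}$ and vectors $c,d\in(\mathbb{R}\cup\{-\infty\})^m$; the question is whether the tropical polyhedron $\{x\in(\mathbb{R}\cup\{-\infty\})^n:\max(\max_{j}(A_{ij}+x_j),c_i)\leq\max(\max_{j}(B_{ij}+x_j),d_i)\ \forall i\in[m]\}$ is empty. Problem (2): the input is a mean payoff game, given by a pair of $m\times n$ matrices $A,B$ with entries in $\mathbb{R}\cup\{-\infty\}$ such that every column of $A$ and every row of $B$ has an entry different from $-\infty$, together with an initial state $r\in[n]$. In this game players Max and Min alternate moves on the disjoint union of $[m]$ and $[n]$; in state $j\in[n]$, Min chooses $i\in[m]$ with $A_{ij}\neq-\infty$, moves to $i$ and receives $A_{ij}$ from Max; in state $i\in[m]$, Max chooses $j\in[n]$ with $B_{ij}\neq-\infty$, moves to $j$ and receives $B_{ij}$ from Min. The dynamic programming operator is $f_j(x)=\min_{i\in[m],A_{ij}\neq-\infty}\bigl(-A_{ij}+\max_{k\in[n]}(B_{ik}+x_k)\bigr)$, and $\chi(f)=\lim_{N\to\infty}f^N(0)/N$ (which exists) is the vector of values of the mean payoff game. The initial state $r$ is winning (for Max) if $\chi_r(f)\geq0$. *)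

theory Defs
  imports "HOL-Library.Extended_Real" "Jordan_Normal_Form.Matrix"
begin

text \<open>
  An element of \<open>\<real> \<union> {-\<infinity>}\<close> is an \<^typ>\<open>ereal\<close> different from \<open>\<infinity>\<close>. Matrices and vectors
  are indexed from 0, so that \<open>[n]\<close> becomes \<open>{..<n}\<close>.
\<close>

definition trop_mat :: "nat \<Rightarrow> nat \<Rightarrow> ereal mat set" where
  "trop_mat m n = {A \<in> carrier_mat m n. \<forall>i<m. \<forall>j<n. A $$ (i, j) \<noteq> \<infinity>}"

definition trop_vec :: "nat \<Rightarrow> ereal vec set" where
  "trop_vec n = {x \<in> carrier_vec n. \<forall>j<n. x $ j \<noteq> \<infinity>}"

definition trop_row :: "ereal mat \<Rightarrow> ereal vec \<Rightarrow> nat \<Rightarrow> ereal" where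
  "trop_row A x i = (MAX j\<in>{..<dim_col A}. A $$ (i, j) + x $ j)"

type_synonym polyhedron_data = "ereal mat \<times> ereal mat \<times> ereal vec \<times> ereal vec"

definition tropical_polyhedron :: "polyhedron_data \<Rightarrow> ereal vec set" where
  "tropical_polyhedron = (\<lambda>(A, B, c, d).
     {x \<in> trop_vec (dim_col A). \<forall>i<dim_row A.
        max (trop_row A x i) (c $ i) \<le> max (trop_row B x i) (d $ i)})"

text \<open>The last component is the initial state, a state of Min.\<close>

type_synonym game_data = "ereal mat \<times> ereal mat \<times> nat"

definition game_operator :: "ereal mat \<Rightarrow> ereal mat \<Rightarrow> ereal vec \<Rightarrow> ereal vec" where
  "game_operator A B x = vec (dim_col A) (\<lambda>j.
     MIN i\<in>{i. i < dim_row A \<and> A $$ (i, j) \<noteq> -\<infinity>}. - A $$ (i, j) + trop_row B x i)"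

definition game_value :: "ereal mat \<Rightarrow> ereal mat \<Rightarrow> nat \<Rightarrow> ereal" where
  "game_value A B j =
     lim (\<lambda>N. (game_operator A B ^^ N) (vec (dim_col A) (\<lambda>_. 0)) $ j / ereal (real N))"

definition winning :: "game_data \<Rightarrow> bool" where
  "winning = (\<lambda>(A, B, r). 0 \<le> game_value A B r)"

text \<open>
  Since the weights are arbitrary elements of \<open>\<real> \<union> {-\<infinity>}\<close>, time is counted on a unit-cost random
  access machine with two memories, one of natural numbers (used for counters and addresses) and
  one of weights, both indirectly addressable. The arithmetic is restricted to addition,
  subtraction and comparison, and the constants in a program are rational or \<open>-\<infinity>\<close>. A weight cell
  can hold any \<^typ>\<open>ereal\<close>, as subtracting \<open>-\<infinity>\<close> gives \<open>\<infinity>\<close>; subtraction of naturals is truncated.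
  The input is a pair of read-only arrays, one for each of the two sorts, accessed through an index;
  the output is written sequentially on a pair of write-only tapes.
\<close>

datatype instr =
    NConst nat nat
  | NAdd nat nat nat
  | NSub nat nat nat
  | NLoad nat nat
  | NStore nat nat
  | NJumpLe nat nat nat
  | NRead nat nat
  | NWrite nat
  | WConst nat rat
  | WMinusInf nat
  | WAdd nat nat nat
  | WSub nat nat nat
  | WLoad nat nat
  | WStore nat nat
  | WJumpLe nat nat nat
  | WRead nat nat
  | WWrite nat

type_synonym data = "nat list \<times> ereal list"

record machine =
  pc :: nat
  nmem :: "nat \<Rightarrow> nat"
  wmem :: "nat \<Rightarrow> ereal"
  nout :: "nat list"
  wout :: "ereal list"

definition input_at :: "'a::zero list \<Rightarrow> nat \<Rightarrow> 'a" where
  "input_at xs k = (if k < length xs then xs ! k else 0)"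

fun exec :: "data \<Rightarrow> instr \<Rightarrow> machine \<Rightarrow> machine" where
  "exec inp (NConst a k) s = s\<lparr>pc := Suc (pc s), nmem := (nmem s)(a := k)\<rparr>"
| "exec inp (NAdd a b c) s = s\<lparr>pc := Suc (pc s), nmem := (nmem s)(a := nmem s b + nmem s c)\<rparr>"
| "exec inp (NSub a b c) s = s\<lparr>pc := Suc (pc s), nmem := (nmem s)(a := nmem s b - nmem s c)\<rparr>"
| "exec inp (NLoad a b) s = s\<lparr>pc := Suc (pc s), nmem := (nmem s)(a := nmem s (nmem s b))\<rparr>"
| "exec inp (NStore a b) s = s\<lparr>pc := Suc (pc s), nmem := (nmem s)(nmem s a := nmem s b)\<rparr>"
| "exec inp (NJumpLe a b l) s = s\<lparr>pc := (if nmem s a \<le> nmem s b then l else Suc (pc s))\<rparr>"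
| "exec inp (NRead a b) s = s\<lparr>pc := Suc (pc s), nmem := (nmem s)(a := input_at (fst inp) (nmem s b))\<rparr>"
| "exec inp (NWrite a) s = s\<lparr>pc := Suc (pc s), nout := nout s @ [nmem s a]\<rparr>"
| "exec inp (WConst a q) s =
     s\<lparr>pc := Suc (pc s), wmem := (wmem s)(a := ereal (real_of_rat q))\<rparr>"
| "exec inp (WMinusInf a) s = s\<lparr>pc := Suc (pc s), wmem := (wmem s)(a := -\<infinity>)\<rparr>"
| "exec inp (WAdd a b c) s = s\<lparr>pc := Suc (pc s), wmem := (wmem s)(a := wmem s b + wmem s c)\<rparr>"
| "exec inp (WSub a b c) s = s\<lparr>pc := Suc (pc s), wmem := (wmem s)(a := wmem s b - wmem s c)\<rparr>"
| "exec inp (WLoad a b) s = s\<lparr>pc := Suc (pc s), wmem := (wmem s)(a := wmem s (nmem s b))\<rparr>"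
| "exec inp (WStore a b) s = s\<lparr>pc := Suc (pc s), wmem := (wmem s)(nmem s a := wmem s b)\<rparr>"
| "exec inp (WJumpLe a b l) s = s\<lparr>pc := (if wmem s a \<le> wmem s b then l else Suc (pc s))\<rparr>"
| "exec inp (WRead a b) s = s\<lparr>pc := Suc (pc s), wmem := (wmem s)(a := input_at (snd inp) (nmem s b))\<rparr>"
| "exec inp (WWrite a) s = s\<lparr>pc := Suc (pc s), wout := wout s @ [wmem s a]\<rparr>"

text \<open>A program halts when the program counter leaves it.\<close>

definition step :: "instr list \<Rightarrow> data \<Rightarrow> machine \<Rightarrow> machine" where
  "step p inp s = (if pc s < length p then exec inp (p ! pc s) s else s)"

definition initial_state :: machine where
  "initial_state = \<lparr>pc = 0, nmem = (\<lambda>_. 0), wmem = (\<lambda>_. 0), nout = [], wout = []\<rparr>"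

definition computes_within :: "instr list \<Rightarrow> data \<Rightarrow> nat \<Rightarrow> data \<Rightarrow> bool" where
  "computes_within p inp t out \<longleftrightarrow>
     (let s = (step p inp ^^ t) initial_state
      in length p \<le> pc s \<and> (nout s, wout s) = out)"

definition data_size :: "data \<Rightarrow> nat" where
  "data_size = (\<lambda>(ns, ws). length ns + length ws)"

record 'i decision_problem =
  instances :: "'i set"
  encoding :: "'i \<Rightarrow> data"
  yes :: "'i \<Rightarrow> bool"

text \<open>
  A solution \<open>x\<close> of the homogenised system with \<open>x\<^sub>r \<noteq> -\<infinity>\<close> witnesses both that the polyhedron is
  nonempty and that the state \<open>r\<close> is winning, so the transformations exchange the two answers:
  emptiness goes to the complement of winning, and winning to the complement of emptiness.
\<close>

definition complement :: "'i decision_problem \<Rightarrow> 'i decision_problem" where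
  "complement P = P\<lparr>yes := (\<lambda>I. \<not> yes P I)\<rparr>"

definition linear_time_transformable :: "'i decision_problem \<Rightarrow> 'j decision_problem \<Rightarrow> bool" where
  "linear_time_transformable P Q \<longleftrightarrow>
     (\<exists>p K. \<forall>I\<in>instances P. \<exists>J\<in>instances Q.
        computes_within p (encoding P I) (K * data_size (encoding P I)) (encoding Q J) \<and>
        (yes P I \<longleftrightarrow> yes Q J))"

text \<open>
  Instances are encoded densely: the dimensions and all entries (including those equal to \<open>-\<infinity>\<close>),
  row by row.
\<close>

definition polyhedron_emptiness :: "polyhedron_data decision_problem" where
  "polyhedron_emptiness =
     \<lparr>instances = {(A, B, c, d). \<exists>m n. 0 < m \<and> 0 < n \<and>
        A \<in> trop_mat m n \<and> B \<in> trop_mat m n \<and> c \<in> trop_vec m \<and> d \<in> trop_vec m},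
      encoding = (\<lambda>(A, B, c, d). ([dim_row A, dim_col A],
        concat (mat_to_list A) @ concat (mat_to_list B) @ list_of_vec c @ list_of_vec d)),
      yes = (\<lambda>I. tropical_polyhedron I = {})\<rparr>"

definition mean_payoff_winning :: "game_data decision_problem" where
  "mean_payoff_winning =
     \<lparr>instances = {(A, B, r). \<exists>m n. 0 < m \<and> 0 < n \<and>
        A \<in> trop_mat m n \<and> B \<in> trop_mat m n \<and>
        (\<forall>j<n. \<exists>i<m. A $$ (i, j) \<noteq> -\<infinity>) \<and> (\<forall>i<m. \<exists>j<n. B $$ (i, j) \<noteq> -\<infinity>) \<and> r < n},
      encoding = (\<lambda>(A, B, r). ([dim_row A, dim_col A, r],
        concat (mat_to_list A) @ concat (mat_to_list B))),
      yes = winning\<rparr>"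

end

theory Submission
  imports Defs
begin

text \<open>
  The bridge between the two problems is the tropical cone of all \<open>x\<close> with \<open>A x \<le> B x\<close>. By residuation
  this inequality says \<open>x \<le> f(x)\<close> for the dynamic programming operator \<open>f\<close> of the game, and the key fact
  (\<open>winning_iff_cone\<close>) is that the state \<open>r\<close> is winning exactly if the cone has a point with
  \<open>x\<^sub>r \<noteq> -\<infinity>\<close>. Given such a point, monotonicity of \<open>f\<close> bounds \<open>f\<^sup>N(0)\<close> at \<open>r\<close> from below, so the
  value is nonnegative.

  For the converse, and for the existence of the value, a direct argument replaces the usual theory of
  invariant half-lines or of positional strategies. Points of the cone are called potentials. If a game has
  no potential besides \<open>-\<infinity>\<close>, consider the variant in which Min may stop at any time, with value iteration
  \<open>x \<mapsto> min x (f x)\<close> from 0. Its values decrease to a potential, hence to \<open>-\<infinity>\<close>, so at some finite time they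
  are all negative. Repeating the corresponding play, Min makes the payoff drift to \<open>-\<infinity>\<close> linearly. In a
  general game this is applied to the states where the greatest nonpositive potential is \<open>-\<infinity>\<close>: Min can stay
  among them for ever, and a nontrivial potential of the game restricted to them could be glued with the
  greatest one, which would contradict maximality. This gives the alternative \<open>potential_or_drift\<close>: each
  state either lies in the support of a potential or has a linear negative drift. Applied to the weights
  shifted by an arbitrary threshold, the same alternative shows that \<open>f\<^sup>N(0)/N\<close> converges.

  The transformations are then short. A game with initial state \<open>r\<close> becomes the affine system \<open>A x \<le> B x\<close>,
  \<open>0 \<le> x\<^sub>r\<close>. An affine system becomes homogeneous by one more variable, which is the initial state; a void
  constraint and a sink variable that is forced to be \<open>-\<infinity>\<close> provide every player with a move in every state.
  Both are computed by programs that copy the input row by row and add constants. The programs are assembled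
  from counting loops, and a calculus of exact running times (\<open>runs_seq\<close>, \<open>runs_for_loop\<close>) shows that they
  take \<open>O(m n)\<close> steps.
\<close>

section \<open>Finite games and potentials\<close>

lemma tendsto_affine_mean: "(\<lambda>N. ereal ((C + a * real N) / real N)) \<longlonglongrightarrow> ereal a"
proof -
  have "(\<lambda>N. C / real N + a) \<longlonglongrightarrow> 0 + a" by (intro tendsto_intros lim_const_over_n)
  moreover have "\<forall>\<^sub>F N in sequentially. C / real N + a = (C + a * real N) / real N"
    using eventually_gt_at_top[of 0] by eventually_elim (simp add: add_divide_distrib)
  ultimately have "(\<lambda>N. (C + a * real N) / real N) \<longlonglongrightarrow> a"
    by (auto elim: Lim_transform_eventually)
  then show ?thesis by simp
qed

lemma mean_ge:
  assumes "\<forall>N. a * real N - C \<le> v N"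
  shows "ereal a \<le> liminf (\<lambda>N. ereal (v N / real N))"
proof -
  have "liminf (\<lambda>N. ereal ((- C + a * real N) / real N)) \<le> liminf (\<lambda>N. ereal (v N / real N))"
    using assms by (intro Liminf_mono always_eventually allI ereal_less_eq(3)[THEN iffD2] divide_right_mono)
      (auto simp: algebra_simps)
  then show ?thesis using lim_imp_Liminf[OF _ tendsto_affine_mean, of "- C" a] by simp
qed

lemma mean_le:
  assumes "\<forall>N. v N \<le> C + a * real N"
  shows "limsup (\<lambda>N. ereal (v N / real N)) \<le> ereal a"
proof -
  have "limsup (\<lambda>N. ereal (v N / real N)) \<le> limsup (\<lambda>N. ereal ((C + a * real N) / real N))"
    using assms by (intro Limsup_mono always_eventually allI ereal_less_eq(3)[THEN iffD2] divide_right_mono)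
      auto
  then show ?thesis using lim_imp_Limsup[OF _ tendsto_affine_mean, of C a] by simp
qed

text \<open>
  Min, at the state \<open>j\<close>, picks \<open>i \<in> moves j\<close>; Max answers with \<open>k \<in> replies i\<close>, receives \<open>w j i k\<close> for
  this pair of moves, and \<open>k\<close> is the next state. The weights are real, since an entry \<open>-\<infinity>\<close> of a game
  matrix only forbids a move.
\<close>

locale finite_game =
  fixes S :: "'s set" and moves :: "'s \<Rightarrow> 'i set" and replies :: "'i \<Rightarrow> 's set"
    and w :: "'s \<Rightarrow> 'i \<Rightarrow> 's \<Rightarrow> real"
  assumes finite_S: "finite S"
    and finite_moves: "j \<in> S \<Longrightarrow> finite (moves j)"
    and moves_nonempty: "j \<in> S \<Longrightarrow> moves j \<noteq> {}"
    and replies_S: "j \<in> S \<Longrightarrow> i \<in> moves j \<Longrightarrow> replies i \<subseteq> S"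
    and replies_nonempty: "j \<in> S \<Longrightarrow> i \<in> moves j \<Longrightarrow> replies i \<noteq> {}"
begin

lemma finite_replies: "j \<in> S \<Longrightarrow> i \<in> moves j \<Longrightarrow> finite (replies i)"
  using finite_S replies_S finite_subset by blast

definition shapley :: "('s \<Rightarrow> real) \<Rightarrow> 's \<Rightarrow> real" where
  "shapley x j = (MIN i\<in>moves j. MAX k\<in>replies i. w j i k + x k)"

definition payoff :: "nat \<Rightarrow> 's \<Rightarrow> real" where
  "payoff N = (shapley ^^ N) (\<lambda>_. 0)"

text \<open>
  For real entries this is \<open>x \<le> shapley x\<close>. Spelled out move by move it keeps its meaning for entries
  \<open>-\<infinity>\<close>, which mark states where the potential promises nothing to Max.
\<close>

definition potential :: "('s \<Rightarrow> ereal) \<Rightarrow> bool" where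
  "potential x \<longleftrightarrow> (\<forall>j\<in>S. x j \<noteq> \<infinity> \<and>
     (\<forall>i\<in>moves j. \<exists>k\<in>replies i. x j \<le> ereal (w j i k) + x k))"

lemma le_shapley_iff:
  assumes "j \<in> S"
  shows "c \<le> shapley x j \<longleftrightarrow> (\<forall>i\<in>moves j. \<exists>k\<in>replies i. c \<le> w j i k + x k)"
  using assms unfolding shapley_def
  by (simp add: Min_ge_iff Max_ge_iff finite_moves finite_replies moves_nonempty replies_nonempty)

lemma shapley_le_iff:
  assumes "j \<in> S"
  shows "shapley x j \<le> c \<longleftrightarrow> (\<exists>i\<in>moves j. \<forall>k\<in>replies i. w j i k + x k \<le> c)"
  using assms unfolding shapley_def
  by (simp add: Min_le_iff Max_le_iff finite_moves finite_replies moves_nonempty replies_nonempty)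

lemma payoff_Suc: "payoff (Suc N) = shapley (payoff N)"
  by (simp add: payoff_def)

lemma potential_bounded_above:
  assumes "potential x"
  obtains t where "\<And>k. k \<in> S \<Longrightarrow> x k \<le> ereal t"
proof -
  have "x k \<le> ereal (\<Sum>j\<in>S. \<bar>real_of_ereal (x j)\<bar>)" if "k \<in> S" for k
  proof -
    have "\<bar>real_of_ereal (x k)\<bar> \<le> (\<Sum>j\<in>S. \<bar>real_of_ereal (x j)\<bar>)"
      by (rule member_le_sum[OF that abs_ge_zero finite_S])
    moreover have "x k \<noteq> \<infinity>" using assms that by (simp add: potential_def)
    ultimately show ?thesis by (cases "x k") auto
  qed
  then show ?thesis using that by blast
qed

lemma potential_shift:
  assumes "potential x"
  shows "potential (\<lambda>j. x j + ereal c)"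
  unfolding potential_def
proof (intro ballI conjI)
  fix j assume j: "j \<in> S"
  then show "x j + ereal c \<noteq> \<infinity>" using assms by (simp add: potential_def)
  fix i assume "i \<in> moves j"
  then obtain k where "k \<in> replies i" "x j \<le> ereal (w j i k) + x k"
    using assms j by (auto simp: potential_def)
  then show "\<exists>k\<in>replies i. x j + ereal c \<le> ereal (w j i k) + (x k + ereal c)"
    by (intro bexI[of _ k]) (auto simp: add.assoc[symmetric] intro: add_right_mono)
qed

text \<open>
  Max answers every move by a reply that witnesses the potential inequality: the payments received
  then make up for every loss of potential, and the final potential is at most \<open>t\<close>.
\<close>

lemma potential_le_payoff:
  assumes x: "potential x" and t: "\<And>k. k \<in> S \<Longrightarrow> x k \<le> ereal t" and "j \<in> S"
  shows "x j \<le> ereal (payoff N j + t)"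
  using \<open>j \<in> S\<close>
proof (induction N arbitrary: j)
  case 0
  then show ?case using t by (simp add: payoff_def)
next
  case (Suc N)
  have "x j \<noteq> \<infinity>" using x Suc.prems by (simp add: potential_def)
  show ?case
  proof (cases "x j")
    case (real r)
    have "r - t \<le> shapley (payoff N) j"
      unfolding le_shapley_iff[OF Suc.prems]
    proof
      fix i assume i: "i \<in> moves j"
      then obtain k where k: "k \<in> replies i" "x j \<le> ereal (w j i k) + x k"
        using x Suc.prems by (auto simp: potential_def)
      then have "x k \<le> ereal (payoff N k + t)" using Suc i replies_S by blast
      with k real have "r - t \<le> w j i k + payoff N k" by (cases "x k") auto
      with k show "\<exists>k\<in>replies i. r - t \<le> w j i k + payoff N k" by blast
    qed
    then show ?thesis by (simp add: real payoff_Suc)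
  qed (use \<open>x j \<noteq> \<infinity>\<close> in auto)
qed

text \<open>
  The value of the game of at most \<open>n\<close> stages that Min may leave at any stage. It decreases in \<open>n\<close>, so
  that a limit exists without any theory of the original game.
\<close>

definition stopping :: "nat \<Rightarrow> 's \<Rightarrow> real" where
  "stopping n = ((\<lambda>x j. min (x j) (shapley x j)) ^^ n) (\<lambda>_. 0)"

lemma stopping_0: "stopping 0 j = 0" by (simp add: stopping_def)
lemma stopping_Suc: "stopping (Suc n) j = min (stopping n j) (shapley (stopping n) j)"
  by (simp add: stopping_def)

lemma stopping_antimono: "m \<le> n \<Longrightarrow> stopping n j \<le> stopping m j"
  by (rule lift_Suc_antimono_le) (auto simp: stopping_Suc)

text \<open>
  The iteration that defines \<^const>\<open>stopping\<close> passes to the limit. If every reply to some move failed in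
  the limit, then, because there are finitely many replies and the sequence decreases, all of them would
  already fail at one common stage.
\<close>

lemma potential_INF_stopping: "potential (\<lambda>j. INF n. ereal (stopping n j))"
  unfolding potential_def
proof (intro ballI conjI)
  let ?y = "\<lambda>j. INF n. ereal (stopping n j)"
  fix j assume j: "j \<in> S"
  have "?y j \<le> ereal (stopping 0 j)" by (rule INF_lower) simp
  then show top: "?y j \<noteq> \<infinity>" by auto
  fix i assume i: "i \<in> moves j"
  show "\<exists>k\<in>replies i. ?y j \<le> ereal (w j i k) + ?y k"
  proof (cases "?y j")
    case (real r)
    show ?thesis
    proof (rule ccontr)
      assume "\<not> ?thesis"
      then have less: "ereal (w j i k) + ?y k < ereal r" if "k \<in> replies i" for k
        using that real by (auto simp: not_le)
      have "\<exists>n. stopping n k < r - w j i k" if "k \<in> replies i" for k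
      proof -
        have "?y k < ereal (r - w j i k)"
          using less[OF that] by (cases "?y k") auto
        then show ?thesis by (auto simp: INF_less_iff)
      qed
      then obtain n where n: "\<And>k. k \<in> replies i \<Longrightarrow> stopping (n k) k < r - w j i k" by metis
      define N where "N = (\<Sum>k\<in>replies i. n k)"
      have N: "w j i k + stopping N k < r" if "k \<in> replies i" for k
      proof -
        have "n k \<le> N" unfolding N_def using that finite_replies[OF j i] by (simp add: member_le_sum)
        then show ?thesis using n[OF that] stopping_antimono[of "n k" N k] by linarith
      qed
      define c where "c = (MAX k\<in>replies i. w j i k + stopping N k)"
      have "c < r" unfolding c_def using N finite_replies[OF j i] replies_nonempty[OF j i] by simp
      have "shapley (stopping N) j \<le> c"
        unfolding shapley_le_iff[OF j] c_def
        by (intro bexI[OF _ i] ballI Max_ge finite_imageI finite_replies[OF j i] imageI)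
      then have "stopping (Suc N) j < r" using \<open>c < r\<close> by (simp add: stopping_Suc)
      moreover have "?y j \<le> ereal (stopping (Suc N) j)" by (rule INF_lower) simp
      ultimately show False using real by auto
    qed
  next
    case MInf
    then show ?thesis using replies_nonempty[OF j i] by auto
  qed (use top in auto)
qed

text \<open>
  Min plays the stopping game for its \<open>k\<close> stages; once that play stops, what remains is an ordinary
  game of between \<open>M - k\<close> and \<open>M\<close> stages, for which \<open>D\<close> is a bound. The surcharge \<open>\<epsilon>\<close> per stage is
  what a strict decrease in the stopping game has to absorb.
\<close>

lemma payoff_le_stopping:
  assumes "0 \<le> \<epsilon>" and "k \<le> M"
    and "\<And>M' j. j \<in> S \<Longrightarrow> M - k \<le> M' \<Longrightarrow> M' \<le> M \<Longrightarrow> payoff M' j + \<epsilon> * real M' \<le> D"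
    and "j \<in> S"
  shows "payoff M j + \<epsilon> * real M \<le> stopping k j + \<epsilon> * real k + D"
  using assms(2-)
proof (induction k arbitrary: M j)
  case 0
  then show ?case by (simp add: stopping_0)
next
  case (Suc k)
  then obtain M0 where M: "M = Suc M0" and M0: "k \<le> M0" by (cases M) auto
  have same: "payoff M j + \<epsilon> * real M \<le> stopping k j + \<epsilon> * real k + D"
    using Suc.prems by (intro Suc.IH) auto
  have prev: "payoff M0 l + \<epsilon> * real M0 \<le> stopping k l + \<epsilon> * real k + D" if "l \<in> S" for l
    using Suc.prems that by (intro Suc.IH) (auto simp: M)
  have "shapley (payoff M0) j \<le> shapley (stopping k) j + \<epsilon> * real k + D - \<epsilon> * real M0"
  proof -
    have "\<exists>i\<in>moves j. \<forall>l\<in>replies i. w j i l + stopping k l \<le> shapley (stopping k) j"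
      using shapley_le_iff[OF \<open>j \<in> S\<close>] by blast
    then obtain i where i: "i \<in> moves j"
      and "\<forall>l\<in>replies i. w j i l + stopping k l \<le> shapley (stopping k) j" by blast
    then have "w j i l + payoff M0 l \<le> shapley (stopping k) j + \<epsilon> * real k + D - \<epsilon> * real M0"
      if "l \<in> replies i" for l
      using prev[of l] that replies_S[OF \<open>j \<in> S\<close> i] by fastforce
    then show ?thesis using i shapley_le_iff[OF \<open>j \<in> S\<close>] by blast
  qed
  then show ?case using same assms(1) by (simp add: stopping_Suc M payoff_Suc algebra_simps min_def)
qed

text \<open>
  Without a nontrivial potential the limit of the stopping values is \<open>-\<infinity>\<close>, hence for one \<open>K\<close> they are
  all below \<open>-1\<close>: from every state Min can bring the balance below \<open>-1\<close> within \<open>K\<close> stages. A surcharge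
  of \<open>\<epsilon>\<close> per stage with \<open>\<epsilon> * K \<le> 1/2\<close> leaves a strict loss, so the surcharged payoff never sets a new
  record after time \<open>K\<close> and stays bounded.
\<close>

lemma payoff_drifts_down:
  assumes trivial: "\<And>x j. potential x \<Longrightarrow> j \<in> S \<Longrightarrow> x j = -\<infinity>"
  shows "\<exists>\<epsilon>>0. \<exists>C. \<forall>j\<in>S. \<forall>N. payoff N j \<le> C - \<epsilon> * real N"
proof -
  have "\<exists>n. stopping n j < -1" if "j \<in> S" for j
  proof -
    have "(INF n. ereal (stopping n j)) < ereal (-1)"
      using trivial[OF potential_INF_stopping that] by simp
    then show ?thesis by (auto simp: INF_less_iff)
  qed
  then obtain n where n: "\<And>j. j \<in> S \<Longrightarrow> stopping (n j) j < -1" by metis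
  define K where "K = (\<Sum>j\<in>S. n j)"
  have K: "stopping K j < -1" if "j \<in> S" for j
  proof -
    have "n j \<le> K" unfolding K_def using that finite_S by (simp add: member_le_sum)
    then show ?thesis using n[OF that] stopping_antimono[of "n j" K j] by linarith
  qed
  define \<epsilon> where "\<epsilon> = 1 / (2 * (real K + 1))"
  have \<epsilon>: "0 < \<epsilon>" "\<epsilon> * real K \<le> 1/2" by (auto simp: \<epsilon>_def field_simps)
  define h where "h M j = payoff M j + \<epsilon> * real M" for M j
  define C where "C = (\<Sum>M\<le>K. \<Sum>j\<in>S. \<bar>h M j\<bar>)"
  have "h M j \<le> C" if "j \<in> S" for M j
    using that
  proof (induction M arbitrary: j rule: less_induct)
    case (less M)
    show ?case
    proof (cases "M \<le> K")
      case True
      have "h M j \<le> (\<Sum>j\<in>S. \<bar>h M j\<bar>)"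
        using member_le_sum[of j S "\<lambda>j. \<bar>h M j\<bar>"] less.prems finite_S by force
      also have "\<dots> \<le> C" unfolding C_def
        by (rule member_le_sum) (use True in \<open>auto intro: sum_nonneg\<close>)
      finally show ?thesis .
    next
      case False
      \<comment> \<open>the record at time \<open>M\<close> would exceed itself by at least \<open>1/2\<close>\<close>
      define D where "D = (MAX j\<in>S. h M j)"
      have D: "h M l \<le> D" if "l \<in> S" for l using that finite_S by (simp add: D_def)
      have "D \<in> h M ` S" unfolding D_def using less.prems finite_S by (intro Max_in) auto
      then obtain l where l: "l \<in> S" "D = h M l" by auto
      have "payoff M l + \<epsilon> * real M \<le> stopping K l + \<epsilon> * real K + max C D"
      proof (rule payoff_le_stopping)
        fix M' j' assume "j' \<in> S" "M' \<le> M"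
        then have "h M' j' \<le> max C D"
          using less.IH[of M' j'] D[of j'] by (cases "M' = M") auto
        then show "payoff M' j' + \<epsilon> * real M' \<le> max C D" by (simp add: h_def)
      qed (use \<epsilon> False l in auto)
      then have "D < max C D" using K[OF l(1)] \<epsilon>(2) l(2) by (simp add: h_def)
      then show ?thesis using D[OF less.prems] by simp
    qed
  qed
  then have "\<forall>j\<in>S. \<forall>N. payoff N j \<le> C - \<epsilon> * real N" by (auto simp: h_def algebra_simps)
  then show ?thesis using \<epsilon>(1) by blast
qed

text \<open>
  Potentials may be shifted by constants, so the bound by 0 loses no support while it makes the supremum
  finite from above.
\<close>

definition greatest_potential :: "'s \<Rightarrow> ereal" where
  "greatest_potential j = (SUP x\<in>{x. potential x \<and> (\<forall>k\<in>S. x k \<le> 0)}. x j)"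

lemma greatest_potential_nonpos: "j \<in> S \<Longrightarrow> greatest_potential j \<le> 0"
  by (auto simp: greatest_potential_def intro: SUP_least)

text \<open>
  A supremum of potentials is a potential: the best reply with respect to the supremum is as good as the
  reply that any single potential provides.
\<close>

lemma potential_greatest_potential: "potential greatest_potential"
  unfolding potential_def
proof (intro ballI conjI)
  fix j assume j: "j \<in> S"
  then show "greatest_potential j \<noteq> \<infinity>" using greatest_potential_nonpos by force
  fix i assume i: "i \<in> moves j"
  define c where "c = (MAX k\<in>replies i. ereal (w j i k) + greatest_potential k)"
  have fin: "finite (replies i)" "replies i \<noteq> {}" using i j finite_replies replies_nonempty by auto
  have "x j \<le> c" if x: "potential x" "\<forall>k\<in>S. x k \<le> 0" for x
  proof -
    obtain k where k: "k \<in> replies i" "x j \<le> ereal (w j i k) + x k"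
      using x(1) i j unfolding potential_def by blast
    have "x k \<le> greatest_potential k"
      unfolding greatest_potential_def by (rule SUP_upper) (use x in auto)
    then have "x j \<le> ereal (w j i k) + greatest_potential k"
      using k(2) add_left_mono order_trans by blast
    also have "\<dots> \<le> c" unfolding c_def using fin k by simp
    finally show ?thesis .
  qed
  then have "greatest_potential j \<le> c" by (auto simp: greatest_potential_def intro: SUP_least)
  then show "\<exists>k\<in>replies i. greatest_potential j \<le> ereal (w j i k) + greatest_potential k"
    unfolding c_def using fin by (simp add: Max_ge_iff)
qed

lemma greatest_potential_finite:
  assumes x: "potential x" and j: "j \<in> S" and "x j \<noteq> -\<infinity>"
  shows "greatest_potential j \<noteq> -\<infinity>"
proof -
  obtain t where t: "\<And>k. k \<in> S \<Longrightarrow> x k \<le> ereal t" using potential_bounded_above[OF x] by blast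
  have "x j + ereal (- t) \<le> greatest_potential j"
    unfolding greatest_potential_def
  proof (rule SUP_upper2)
    show "(\<lambda>k. x k + ereal (- t)) \<in> {x. potential x \<and> (\<forall>k\<in>S. x k \<le> 0)}"
    proof (safe)
      show "potential (\<lambda>k. x k + ereal (- t))" by (rule potential_shift[OF x])
      fix k assume "k \<in> S"
      with t[OF this] show "x k + ereal (- t) \<le> 0" by (cases "x k") auto
    qed
  qed simp
  then show ?thesis using \<open>x j \<noteq> -\<infinity>\<close> by (cases "x j") auto
qed

definition losing :: "'s set" where
  "losing = {j\<in>S. greatest_potential j = -\<infinity>}"

text \<open>
  A vector that is a potential as long as Min stays inside the losing region can be glued with the greatest
  potential outside. Shifted down far enough, it lies below everything that Max can reach by leaving the
  region, so the result is a potential of the whole game; by the choice of the region it is trivial there.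
\<close>

lemma no_potential_on_losing:
  assumes top: "\<And>j. j \<in> losing \<Longrightarrow> y j \<noteq> \<infinity>"
    and y: "\<And>j i. j \<in> losing \<Longrightarrow> i \<in> moves j \<Longrightarrow> replies i \<subseteq> losing
      \<Longrightarrow> \<exists>k\<in>replies i. y j \<le> ereal (w j i k) + y k"
    and j: "j \<in> losing"
  shows "y j = -\<infinity>"
proof (rule ccontr)
  assume yj: "y j \<noteq> -\<infinity>"
  let ?g = greatest_potential
  define E where "E = (SIGMA j:S. SIGMA i:moves j. replies i)"
  have finE: "finite E" unfolding E_def
    by (intro finite_SigmaI finite_S finite_moves finite_replies)
  \<comment> \<open>a shift that suffices for each of the finitely many ways of leaving the region\<close>
  define c where "c = (\<Sum>(j,i,k)\<in>E. \<bar>real_of_ereal (y j) - w j i k - real_of_ereal (?g k)\<bar>)"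
  have c: "y j + ereal (- c) \<le> ereal (w j i k) + ?g k"
    if "j \<in> losing" "i \<in> moves j" "k \<in> replies i" "k \<notin> losing" for j i k
  proof -
    have jS: "j \<in> S" using that by (simp add: losing_def)
    have kS: "k \<in> S" using replies_S[OF jS] that by blast
    have "(j, i, k) \<in> E" using that jS by (simp add: E_def)
    then have "\<bar>real_of_ereal (y j) - w j i k - real_of_ereal (?g k)\<bar> \<le> c"
      unfolding c_def using member_le_sum[OF _ _ finE,
          of "(j,i,k)" "\<lambda>(j,i,k). \<bar>real_of_ereal (y j) - w j i k - real_of_ereal (?g k)\<bar>"] by auto
    moreover have "?g k \<noteq> -\<infinity>" "?g k \<noteq> \<infinity>"
      using kS that potential_greatest_potential by (auto simp: losing_def potential_def)
    ultimately show ?thesis using top[OF that(1)] by (cases "y j"; cases "?g k") auto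
  qed
  define z where "z k = (if k \<in> losing then y k + ereal (- c) else ?g k)" for k
  have "potential z"
    unfolding potential_def
  proof (intro ballI conjI)
    fix j assume jS: "j \<in> S"
    show "z j \<noteq> \<infinity>"
      using jS top potential_greatest_potential by (auto simp: z_def potential_def)
    fix i assume i: "i \<in> moves j"
    show "\<exists>k\<in>replies i. z j \<le> ereal (w j i k) + z k"
    proof (cases "j \<in> losing")
      case False
      obtain k where k: "k \<in> replies i" "?g j \<le> ereal (w j i k) + ?g k"
        using potential_greatest_potential i jS by (auto simp: potential_def)
      then have "k \<notin> losing" using False jS by (auto simp: losing_def)
      then show ?thesis using k False by (auto simp: z_def)
    next
      case True
      show ?thesis
      proof (cases "replies i \<subseteq> losing")
        case sub: True
        then obtain k where k: "k \<in> replies i" "y j \<le> ereal (w j i k) + y k"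
          using y[OF True i] by blast
        then have "z j \<le> ereal (w j i k) + z k"
          using True sub by (auto simp: z_def add.assoc[symmetric] intro: add_right_mono)
        then show ?thesis using k by blast
      next
        case False
        then obtain k where k: "k \<in> replies i" "k \<notin> losing" by blast
        then have "z j \<le> ereal (w j i k) + z k" using c[OF True i k] True by (simp add: z_def)
        then show ?thesis using k by blast
      qed
    qed
  qed
  moreover have "z j \<noteq> -\<infinity>" using j yj by (cases "y j") (auto simp: z_def)
  ultimately have "?g j \<noteq> -\<infinity>" using greatest_potential_finite j by (auto simp: losing_def)
  then show False using j by (simp add: losing_def)
qed

text \<open>
  Otherwise the vector that is 0 at \<open>j\<close> and \<open>-\<infinity>\<close> elsewhere would satisfy the gluing condition, vacuously
  at \<open>j\<close>. So Min can stay in the losing region for ever, and the game restricted to it is again a game.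
\<close>

lemma losing_trap:
  assumes "j \<in> losing"
  shows "\<exists>i\<in>moves j. replies i \<subseteq> losing"
proof (rule ccontr)
  assume no: "\<not> ?thesis"
  define y :: "'s \<Rightarrow> ereal" where "y k = (if k = j then 0 else -\<infinity>)" for k
  have "y j = -\<infinity>"
  proof (rule no_potential_on_losing[OF _ _ assms])
    fix l i assume l: "l \<in> losing" and i: "i \<in> moves l" "replies i \<subseteq> losing"
    then have "l \<noteq> j" using no by blast
    then show "\<exists>k\<in>replies i. y l \<le> ereal (w l i k) + y k"
      using l i replies_nonempty[of l i] by (auto simp: y_def losing_def)
  qed (simp add: y_def)
  then show False by (simp add: y_def)
qed

text \<open>
  The alternative behind the whole development: either Max has a certificate at \<open>j\<close>, or Min makes the
  balance drift to \<open>-\<infinity>\<close> linearly. In the second case \<open>j\<close> is losing, and in the game restricted to the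
  losing region, where Min only has fewer moves, there is no nontrivial potential.
\<close>

lemma potential_or_drift:
  assumes j: "j \<in> S"
  shows "(\<exists>x. potential x \<and> x j \<noteq> -\<infinity>) \<or> (\<exists>\<epsilon>>0. \<exists>C. \<forall>N. payoff N j \<le> C - \<epsilon> * real N)"
proof (cases "j \<in> losing")
  case False
  then show ?thesis using j potential_greatest_potential by (auto simp: losing_def)
next
  case True
  interpret trap: finite_game losing "\<lambda>j. {i\<in>moves j. replies i \<subseteq> losing}" replies w
  proof
    show "finite losing" using finite_S by (simp add: losing_def)
    show "{i \<in> moves j. replies i \<subseteq> losing} \<noteq> {}" if "j \<in> losing" for j
      using losing_trap[OF that] by blast
  qed (use finite_moves replies_nonempty in \<open>auto simp: losing_def\<close>)
  have "x j = -\<infinity>" if "trap.potential x" "j \<in> losing" for x j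
    using that(1) by (intro no_potential_on_losing[OF _ _ that(2)]) (auto simp: trap.potential_def)
  then obtain \<epsilon> C where e: "\<epsilon> > 0"
    and le: "\<And>j N. j \<in> losing \<Longrightarrow> trap.payoff N j \<le> C - \<epsilon> * real N"
    using trap.payoff_drifts_down by blast
  have "payoff N j \<le> trap.payoff N j" if "j \<in> losing" for N j
    using that
  proof (induction N arbitrary: j)
    case 0
    then show ?case by (simp add: payoff_def trap.payoff_def)
  next
    case (Suc N)
    obtain i where i: "i \<in> moves j" "replies i \<subseteq> losing"
      "\<forall>k\<in>replies i. w j i k + trap.payoff N k \<le> trap.payoff (Suc N) j"
      using trap.shapley_le_iff[OF Suc.prems, of "trap.payoff N" "trap.payoff (Suc N) j"]
      by (auto simp: trap.payoff_Suc)
    have "w j i k + payoff N k \<le> trap.payoff (Suc N) j" if "k \<in> replies i" for k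
      using i that Suc.IH[of k] by fastforce
    moreover have "j \<in> S" using Suc.prems by (simp add: losing_def)
    ultimately show ?case using i(1) by (auto simp: payoff_Suc shapley_le_iff)
  qed
  then have "\<forall>N. payoff N j \<le> C - \<epsilon> * real N" using le True order_trans by blast
  then show ?thesis using e by blast
qed

text \<open>
  The alternative applied to the game whose weights are decreased by \<open>\<theta>\<close>, which compares the mean
  payoff with \<open>\<theta>\<close>.
\<close>

lemma threshold:
  assumes j: "j \<in> S"
  shows "(\<exists>C. \<forall>N. \<theta> * real N - C \<le> payoff N j) \<or>
     (\<exists>\<epsilon>>0. \<exists>C. \<forall>N. payoff N j \<le> C + (\<theta> - \<epsilon>) * real N)"
proof -
  interpret shift: finite_game S moves replies "\<lambda>j i k. w j i k - \<theta>"
    by standard (use finite_S finite_moves moves_nonempty replies_S replies_nonempty in auto)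
  have pay: "shift.payoff N j = payoff N j - \<theta> * real N" if "j \<in> S" for j N
    using that
  proof (induction N arbitrary: j)
    case 0
    then show ?case by (simp add: payoff_def shift.payoff_def)
  next
    case (Suc N)
    have eq: "w j i k - \<theta> + shift.payoff N k = w j i k + payoff N k - \<theta> * real (Suc N)"
      if "i \<in> moves j" "k \<in> replies i" for i k
    proof -
      have "k \<in> S" using replies_S[OF Suc.prems that(1)] that(2) by blast
      then show ?thesis by (simp add: Suc.IH algebra_simps)
    qed
    have "c \<le> shift.payoff (Suc N) j \<longleftrightarrow> c + \<theta> * real (Suc N) \<le> payoff (Suc N) j" for c
      unfolding shift.payoff_Suc payoff_Suc shift.le_shapley_iff[OF Suc.prems] le_shapley_iff[OF Suc.prems]
      by (intro ball_cong bex_cong refl) (use eq in \<open>force simp: algebra_simps\<close>)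
    from this[of "shift.payoff (Suc N) j"] this[of "payoff (Suc N) j - \<theta> * real (Suc N)"]
    show ?case by simp
  qed
  from shift.potential_or_drift[OF j] show ?thesis
  proof (elim disjE exE conjE)
    fix x assume x: "shift.potential x" "x j \<noteq> -\<infinity>"
    obtain t where t: "\<And>k. k \<in> S \<Longrightarrow> x k \<le> ereal t" using shift.potential_bounded_above[OF x(1)] by blast
    obtain u where u: "x j = ereal u"
      using x j by (cases "x j") (auto simp: shift.potential_def)
    have "\<theta> * real N - (t - u) \<le> payoff N j" for N
      using shift.potential_le_payoff[OF x(1) t j, of N] pay[OF j, of N] u by simp
    then show ?thesis by blast
  next
    fix \<epsilon> C assume "\<epsilon> > 0" and "\<forall>N. shift.payoff N j \<le> C - \<epsilon> * real N"
    then have "\<forall>N. payoff N j \<le> C + (\<theta> - \<epsilon>) * real N" using pay[OF j] by (simp add: algebra_simps)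
    then show ?thesis using \<open>\<epsilon> > 0\<close> by blast
  qed
qed

text \<open>
  A real number strictly between the two limits would violate both alternatives of the threshold lemma.
  This yields the existence of the value.
\<close>

lemma limsup_mean_payoff_eq_liminf:
  assumes j: "j \<in> S"
  shows "limsup (\<lambda>N. ereal (payoff N j / real N)) = liminf (\<lambda>N. ereal (payoff N j / real N))"
    (is "?u = ?l")
proof (rule antisym[OF _ Liminf_le_Limsup])
  show "?u \<le> ?l"
  proof (rule ccontr)
    assume "\<not> ?u \<le> ?l"
    then obtain \<theta> where \<theta>: "?l < ereal \<theta>" "ereal \<theta> < ?u" using ereal_dense2 by (meson not_le)
    from threshold[OF j, of \<theta>] show False
    proof (elim disjE exE conjE)
      fix C assume "\<forall>N. \<theta> * real N - C \<le> payoff N j"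
      from mean_ge[OF this] show False using \<theta>(1) by simp
    next
      fix \<epsilon> C assume "\<epsilon> > 0" "\<forall>N. payoff N j \<le> C + (\<theta> - \<epsilon>) * real N"
      then have "?u \<le> ereal (\<theta> - \<epsilon>)" by (intro mean_le[where C = C])
      also have "\<dots> < ereal \<theta>" using \<open>\<epsilon> > 0\<close> by simp
      finally show False using \<theta>(2) by simp
    qed
  qed
qed simp

text \<open>
  A drift is linear, so it makes the mean payoff strictly negative; a potential keeps the payoff bounded
  below, so it makes the mean payoff nonnegative.
\<close>

lemma value_nonneg_iff_potential:
  assumes j: "j \<in> S"
  shows "0 \<le> lim (\<lambda>N. ereal (payoff N j / real N)) \<longleftrightarrow> (\<exists>x. potential x \<and> x j \<noteq> -\<infinity>)"
proof -
  let ?v = "\<lambda>N. ereal (payoff N j / real N)"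
  have "?v \<longlonglongrightarrow> liminf ?v"
    using limsup_mean_payoff_eq_liminf[OF j] by (intro Liminf_eq_Limsup) auto
  then have lim: "lim ?v = liminf ?v" by (rule limI)
  show ?thesis
  proof
    assume "0 \<le> lim ?v"
    show "\<exists>x. potential x \<and> x j \<noteq> -\<infinity>"
    proof (rule ccontr)
      assume "\<not> ?thesis"
      then obtain \<epsilon> C where "\<epsilon> > 0" and "\<forall>N. payoff N j \<le> C - \<epsilon> * real N"
        using potential_or_drift[OF j] by blast
      then have "limsup ?v \<le> ereal (- \<epsilon>)" by (intro mean_le[where C = C]) simp
      then show False
        using order_trans[of 0 "liminf ?v" "ereal (- \<epsilon>)"] \<open>0 \<le> lim ?v\<close> \<open>\<epsilon> > 0\<close>
        by (simp add: lim limsup_mean_payoff_eq_liminf[OF j])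
    qed
  next
    assume "\<exists>x. potential x \<and> x j \<noteq> -\<infinity>"
    then obtain x where x: "potential x" "x j \<noteq> -\<infinity>" by blast
    obtain t where t: "\<And>k. k \<in> S \<Longrightarrow> x k \<le> ereal t" using potential_bounded_above[OF x(1)] by blast
    obtain u where u: "x j = ereal u" using x j by (cases "x j") (auto simp: potential_def)
    have "0 * real N - (t - u) \<le> payoff N j" for N
      using potential_le_payoff[OF x(1) t j, of N] u by simp
    then have "ereal 0 \<le> liminf ?v" by (intro mean_ge[where C = "t - u"] allI)
    then show "0 \<le> lim ?v" using lim by (simp add: zero_ereal_def)
  qed
qed

end

section \<open>Games given by tropical matrices\<close>

lemma trop_row_le_iff: "0 < dim_col A \<Longrightarrow> trop_row A x i \<le> c \<longleftrightarrow> (\<forall>j<dim_col A. A $$ (i, j) + x $ j \<le> c)"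
  unfolding trop_row_def by (subst Max_le_iff) auto

lemma le_trop_row_iff: "0 < dim_col A \<Longrightarrow> c \<le> trop_row A x i \<longleftrightarrow> (\<exists>j<dim_col A. c \<le> A $$ (i, j) + x $ j)"
  unfolding trop_row_def by (subst Max_ge_iff) auto

lemma trop_row_shift:
  assumes "0 < dim_col A" "dim_vec x = dim_col A"
  shows "trop_row A (vec (dim_col A) (\<lambda>j. x $ j + ereal c)) i = trop_row A x i + ereal c"
proof -
  have "trop_row A (vec (dim_col A) (\<lambda>j. x $ j + ereal c)) i =
      Max ((\<lambda>y. y + ereal c) ` (\<lambda>j. A $$ (i, j) + x $ j) ` {..<dim_col A})"
    unfolding trop_row_def image_image by (rule arg_cong[where f = Max]) (auto simp: add.assoc)
  also have "\<dots> = trop_row A x i + ereal c"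
    unfolding trop_row_def
    by (rule mono_Max_commute[symmetric]) (use assms in \<open>auto intro!: monoI add_right_mono\<close>)
  finally show ?thesis .
qed

definition homogeneous_cone :: "ereal mat \<Rightarrow> ereal mat \<Rightarrow> ereal vec set" where
  "homogeneous_cone A B = {x \<in> trop_vec (dim_col A). \<forall>i<dim_row A. trop_row A x i \<le> trop_row B x i}"

text \<open>
  The matrices of a mean payoff game; they induce a finite game in which an entry \<open>-\<infinity>\<close> is a missing
  move and the weight of a pair of moves is \<open>B\<^sub>i\<^sub>k - A\<^sub>i\<^sub>j\<close>.
\<close>

locale game_matrices =
  fixes A B :: "ereal mat" and m n :: nat
  assumes A: "A \<in> trop_mat m n" and B: "B \<in> trop_mat m n"
    and columns: "\<And>j. j < n \<Longrightarrow> \<exists>i<m. A $$ (i, j) \<noteq> -\<infinity>"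
    and rows: "\<And>i. i < m \<Longrightarrow> \<exists>j<n. B $$ (i, j) \<noteq> -\<infinity>"
begin

lemma dims [simp]: "dim_row A = m" "dim_col A = n" "dim_row B = m" "dim_col B = n"
  using A B by (auto simp: trop_mat_def)

definition "moves j = {i. i < m \<and> A $$ (i, j) \<noteq> -\<infinity>}"
definition "replies i = {k. k < n \<and> B $$ (i, k) \<noteq> -\<infinity>}"
definition "weight j i k = real_of_ereal (B $$ (i, k)) - real_of_ereal (A $$ (i, j))"

sublocale finite_game "{..<n}" moves replies weight
  using columns rows by unfold_locales (auto simp: moves_def replies_def)

lemma A_finite: "j < n \<Longrightarrow> i \<in> moves j \<Longrightarrow> A $$ (i, j) = ereal (real_of_ereal (A $$ (i, j)))"
  using A by (cases "A $$ (i, j)") (auto simp: trop_mat_def moves_def)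

lemma B_finite: "i < m \<Longrightarrow> k \<in> replies i \<Longrightarrow> B $$ (i, k) = ereal (real_of_ereal (B $$ (i, k)))"
  using B by (cases "B $$ (i, k)") (auto simp: trop_mat_def replies_def)

lemma trop_row_B_real:
  assumes i: "i < m"
  shows "trop_row B (vec n (\<lambda>k. ereal (x k))) i =
    ereal (MAX k\<in>replies i. real_of_ereal (B $$ (i, k)) + x k)" (is "?l = ereal ?r")
proof (rule antisym)
  have fin: "finite (replies i)" by (simp add: replies_def)
  obtain j where j: "j \<in> replies i" "j < n" using rows[OF i] by (auto simp: replies_def)
  show "?l \<le> ereal ?r"
    unfolding trop_row_def
  proof (rule Max.boundedI)
    fix y assume "y \<in> (\<lambda>k. B $$ (i, k) + vec n (\<lambda>k. ereal (x k)) $ k) ` {..<dim_col B}"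
    then obtain k where k: "k < n" "y = B $$ (i, k) + ereal (x k)" by auto
    show "y \<le> ereal ?r"
    proof (cases "k \<in> replies i")
      case True
      then have "y = ereal (real_of_ereal (B $$ (i, k)) + x k)"
        using k B_finite[OF i True] by (metis plus_ereal.simps(1))
      then show ?thesis using True fin by simp
    next
      case False
      then show ?thesis using k by (simp add: replies_def)
    qed
  qed (use j in auto)
  have "?r \<in> (\<lambda>k. real_of_ereal (B $$ (i, k)) + x k) ` replies i"
    using fin j by (intro Max_in) auto
  then obtain k where k: "k \<in> replies i" "?r = real_of_ereal (B $$ (i, k)) + x k" by auto
  then have "ereal ?r = B $$ (i, k) + ereal (x k)" using B_finite[OF i k(1)] by (metis plus_ereal.simps(1))
  moreover have "k < n" using k by (simp add: replies_def)
  ultimately show "ereal ?r \<le> ?l"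
    unfolding trop_row_def by (intro Max_ge) auto
qed

lemma game_operator_real:
  "game_operator A B (vec n (\<lambda>k. ereal (x k))) = vec n (\<lambda>j. ereal (shapley x j))"
proof (rule eq_vecI)
  fix j assume "j < dim_vec (vec n (\<lambda>j. ereal (shapley x j)))"
  then have j: "j < n" by simp
  let ?f = "\<lambda>i. MAX k\<in>replies i. weight j i k + x k"
  have "- A $$ (i, j) + trop_row B (vec n (\<lambda>k. ereal (x k))) i = ereal (?f i)" if i: "i \<in> moves j" for i
  proof -
    let ?a = "real_of_ereal (A $$ (i, j))"
    have im: "i < m" using i by (simp add: moves_def)
    have "?f i = Max ((\<lambda>y. - ?a + y) ` (\<lambda>k. real_of_ereal (B $$ (i, k)) + x k) ` replies i)"
      unfolding image_image weight_def by (rule arg_cong[where f = Max]) auto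
    also have "\<dots> = - ?a + (MAX k\<in>replies i. real_of_ereal (B $$ (i, k)) + x k)"
      using rows[OF im] by (intro mono_Max_commute[symmetric] monoI) (auto simp: replies_def)
    finally show ?thesis
      using A_finite[OF j i] trop_row_B_real[OF im] by (metis plus_ereal.simps(1) uminus_ereal.simps(1))
  qed
  then have "(MIN i\<in>moves j. - A $$ (i, j) + trop_row B (vec n (\<lambda>k. ereal (x k))) i) =
      Min (ereal ` ?f ` moves j)"
    unfolding image_image by (intro arg_cong[where f = Min] image_cong) auto
  also have "\<dots> = ereal (shapley x j)"
    unfolding shapley_def using columns[OF j]
    by (intro mono_Min_commute[symmetric] monoI) (auto simp: moves_def)
  finally show "game_operator A B (vec n (\<lambda>k. ereal (x k))) $ j = vec n (\<lambda>j. ereal (shapley x j)) $ j"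
    using j by (simp add: game_operator_def moves_def)
qed (simp add: game_operator_def)

lemma game_operator_iterate:
  "(game_operator A B ^^ N) (vec n (\<lambda>_. 0)) = vec n (\<lambda>j. ereal (payoff N j))"
proof (induction N)
  case (Suc N)
  then show ?case by (simp add: game_operator_real payoff_Suc)
qed (simp add: payoff_def zero_ereal_def)

lemma game_value_payoff:
  assumes j: "j < n"
  shows "game_value A B j = lim (\<lambda>N. ereal (payoff N j / real N))"
proof -
  have eq: "(game_operator A B ^^ N) (vec (dim_col A) (\<lambda>_. 0)) $ j / ereal (real N) = ereal (payoff N j / real N)"
    if "N > 0" for N
    using that j by (simp add: game_operator_iterate)
  have ev: "\<forall>\<^sub>F N in sequentially. (game_operator A B ^^ N) (vec (dim_col A) (\<lambda>_. 0)) $ j / ereal (real N)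
      = ereal (payoff N j / real N)"
    using eventually_gt_at_top[of 0] by eventually_elim (rule eq)
  have "(\<lambda>N. (game_operator A B ^^ N) (vec (dim_col A) (\<lambda>_. 0)) $ j / ereal (real N)) \<longlonglongrightarrow> L
      \<longleftrightarrow> (\<lambda>N. ereal (payoff N j / real N)) \<longlonglongrightarrow> L" for L
    by (rule tendsto_cong[OF ev])
  then show ?thesis by (simp add: game_value_def lim_def)
qed

text \<open>
  Residuation: the inequality between row \<open>i\<close> of \<open>A\<close> and row \<open>i\<close> of \<open>B\<close> says that each term
  \<open>A\<^sub>i\<^sub>j + x\<^sub>j\<close> is at most some \<open>B\<^sub>i\<^sub>k + x\<^sub>k\<close>. Terms equal to \<open>-\<infinity>\<close> impose nothing.
\<close>

lemma cone_potential_iff: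
  assumes x: "x \<in> trop_vec n" and "0 < n"
  shows "x \<in> homogeneous_cone A B \<longleftrightarrow> potential (\<lambda>j. x $ j)"
proof -
  have top: "x $ j \<noteq> \<infinity>" if "j < n" for j using x that by (simp add: trop_vec_def)
  have entry: "A $$ (i, j) + x $ j \<le> trop_row B x i \<longleftrightarrow>
      (i \<in> moves j \<longrightarrow> (\<exists>k\<in>replies i. x $ j \<le> ereal (weight j i k) + x $ k))"
    if i: "i < m" and j: "j < n" for i j
  proof (cases "i \<in> moves j \<and> x $ j \<noteq> -\<infinity>")
    case False
    then have "A $$ (i, j) + x $ j = -\<infinity>" using i j top[OF j] A
      by (auto simp: moves_def trop_mat_def ereal_plus_eq_MInfty)
    then have "A $$ (i, j) + x $ j \<le> trop_row B x i" by (simp only: ereal_less_eq)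
    moreover have "\<exists>k. k \<in> replies i" using rows[OF i] by (auto simp: replies_def)
    ultimately show ?thesis using False by auto
  next
    case True
    define a where "a = real_of_ereal (A $$ (i, j))"
    have a: "A $$ (i, j) = ereal a" using A_finite[OF j] True by (simp add: a_def)
    obtain u where u: "x $ j = ereal u" using True top[OF j] by (cases "x $ j") auto
    have "A $$ (i, j) + x $ j \<le> B $$ (i, k) + x $ k \<longleftrightarrow>
        k \<in> replies i \<and> x $ j \<le> ereal (weight j i k) + x $ k" if k: "k < n" for k
    proof (cases "k \<in> replies i")
      case True
      then show ?thesis using B_finite[OF i True] a u top[OF k]
        by (cases "B $$ (i, k)"; cases "x $ k") (auto simp: weight_def)
    next
      case False
      then have "B $$ (i, k) = -\<infinity>" using k by (simp add: replies_def)
      then show ?thesis using False a u top[OF k] by (cases "x $ k") auto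
    qed
    moreover have "k < n" if "k \<in> replies i" for k using that by (simp add: replies_def)
    ultimately show ?thesis using True \<open>0 < n\<close> by (auto simp: le_trop_row_iff)
  qed
  show ?thesis
    unfolding homogeneous_cone_def potential_def using x \<open>0 < n\<close> top
    by (simp add: trop_row_le_iff entry) (auto simp: moves_def)
qed

lemma winning_iff_cone:
  assumes r: "r < n"
  shows "winning (A, B, r) \<longleftrightarrow> (\<exists>x\<in>homogeneous_cone A B. x $ r \<noteq> -\<infinity>)"
proof -
  have "winning (A, B, r) \<longleftrightarrow> (\<exists>x. potential x \<and> x r \<noteq> -\<infinity>)"
    using r value_nonneg_iff_potential[of r] by (simp add: winning_def game_value_payoff)
  also have "\<dots> \<longleftrightarrow> (\<exists>x\<in>homogeneous_cone A B. x $ r \<noteq> -\<infinity>)"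
  proof
    assume "\<exists>x. potential x \<and> x r \<noteq> -\<infinity>"
    then obtain x where x: "potential x" "x r \<noteq> -\<infinity>" by blast
    have "vec n x \<in> trop_vec n" using x(1) by (auto simp: trop_vec_def potential_def)
    moreover have "potential (\<lambda>j. vec n x $ j)"
      unfolding potential_def
    proof (intro ballI conjI)
      fix j assume j: "j \<in> {..<n}"
      then show "vec n x $ j \<noteq> \<infinity>" using x(1) by (simp add: potential_def)
      fix i assume i: "i \<in> moves j"
      then obtain k where k: "k \<in> replies i" "x j \<le> ereal (weight j i k) + x k"
        using x(1) j unfolding potential_def by blast
      moreover have "k < n" using k by (simp add: replies_def)
      ultimately show "\<exists>k\<in>replies i. vec n x $ j \<le> ereal (weight j i k) + vec n x $ k"
        using j by (intro bexI[of _ k]) auto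
    qed
    ultimately have "vec n x \<in> homogeneous_cone A B" using cone_potential_iff r by simp
    moreover have "vec n x $ r \<noteq> -\<infinity>" using x r by simp
    ultimately show "\<exists>x\<in>homogeneous_cone A B. x $ r \<noteq> -\<infinity>" by blast
  next
    assume "\<exists>x\<in>homogeneous_cone A B. x $ r \<noteq> -\<infinity>"
    then obtain x where x: "x \<in> homogeneous_cone A B" "x $ r \<noteq> -\<infinity>" by blast
    then have "x \<in> trop_vec n" by (simp add: homogeneous_cone_def)
    then have "potential (\<lambda>j. x $ j)" using cone_potential_iff r x(1) by simp
    with x(2) show "\<exists>x. potential x \<and> x r \<noteq> -\<infinity>" by blast
  qed
  finally show ?thesis .
qed

end

section \<open>Translations between games and polyhedra\<close>

text \<open>
  The matrix with the rows \<open>(M v x)\<close>, \<open>(-\<infinity> -\<infinity> y)\<close> and \<open>(0 0 0)\<close>. The column \<open>v\<close> belongs to the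
  homogenising variable, the last column to a sink variable.
\<close>

definition bordered :: "ereal mat \<Rightarrow> ereal vec \<Rightarrow> ereal \<Rightarrow> ereal \<Rightarrow> ereal mat" where
  "bordered M v x y = mat (dim_row M + 2) (dim_col M + 2) (\<lambda>(i, j).
     if i < dim_row M then (if j < dim_col M then M $$ (i, j) else if j = dim_col M then v $ i else x)
     else if i = dim_row M then (if j \<le> dim_col M then -\<infinity> else y)
     else 0)"

text \<open>
  The matrices of a game must have a finite entry in every column of \<open>A\<close> and in every row of \<open>B\<close>. The
  last row of zeros, equal on both sides, is a void constraint that settles the columns. The entries 0 of
  the sink column of \<open>B\<close> settle the rows; they change nothing, because the row before the last one reads
  \<open>x \<le> x - 1\<close> for the sink variable and so forces it to be \<open>-\<infinity>\<close>. Two more rows and columns are enough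
  in total, which keeps the size linear; a repair of each deficient row and column by its own would not.
\<close>

definition game_of_polyhedron :: "polyhedron_data \<Rightarrow> game_data" where
  "game_of_polyhedron = (\<lambda>(A, B, c, d). (bordered A c (-\<infinity>) 0, bordered B d 0 (-1), dim_col A))"

text \<open>
  The additional row is the constraint \<open>0 \<le> x\<^sub>r\<close>; since the other rows are invariant under adding a
  constant to \<open>x\<close>, it is equivalent to \<open>x\<^sub>r \<noteq> -\<infinity>\<close>.
\<close>

definition polyhedron_of_game :: "game_data \<Rightarrow> polyhedron_data" where
  "polyhedron_of_game = (\<lambda>(A, B, r). let m = dim_row A; n = dim_col A in
     (mat (Suc m) n (\<lambda>(i, j). if i < m then A $$ (i, j) else -\<infinity>),
      mat (Suc m) n (\<lambda>(i, j). if i < m then B $$ (i, j) else if j = r then 0 else -\<infinity>),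
      vec (Suc m) (\<lambda>i. if i < m then -\<infinity> else 0),
      vec (Suc m) (\<lambda>_. -\<infinity>)))"

lemma dim_bordered [simp]:
  "dim_row (bordered M v x y) = dim_row M + 2" "dim_col (bordered M v x y) = dim_col M + 2"
  by (auto simp: bordered_def)

lemma bordered_trop_mat:
  assumes M: "M \<in> trop_mat m n" and v: "v \<in> trop_vec m" and "x \<noteq> \<infinity>" "y \<noteq> \<infinity>"
  shows "bordered M v x y \<in> trop_mat (m + 2) (n + 2)"
proof -
  have dim: "dim_row M = m" "dim_col M = n" using M by (auto simp: trop_mat_def)
  have "bordered M v x y $$ (i, j) \<noteq> \<infinity>" if "i < m + 2" "j < n + 2" for i j
  proof -
    have "i < m \<Longrightarrow> j < n \<Longrightarrow> M $$ (i, j) \<noteq> \<infinity>" using M by (simp add: trop_mat_def)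
    moreover have "i < m \<Longrightarrow> v $ i \<noteq> \<infinity>" using v by (simp add: trop_vec_def)
    ultimately show ?thesis using that assms(3,4) by (simp add: bordered_def dim)
  qed
  moreover have "bordered M v x y \<in> carrier_mat (m + 2) (n + 2)"
    by (rule carrier_matI) (simp_all only: dim_bordered dim)
  ultimately show ?thesis unfolding trop_mat_def by blast
qed

lemma trop_row_bordered:
  assumes i: "i < dim_row M" and "0 < dim_col M" and "a \<noteq> \<infinity>"
    and z: "z = vec (dim_col M + 2) (\<lambda>j. if j < dim_col M then x $ j else if j = dim_col M then s else -\<infinity>)"
  shows "trop_row (bordered M v a b) z i = max (trop_row M x i) (v $ i + s)"
proof (rule antisym)
  let ?n = "dim_col M" and ?M = "bordered M v a b"
  have entry: "?M $$ (i, j) + z $ j =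
      (if j < ?n then M $$ (i, j) + x $ j else if j = ?n then v $ i + s else -\<infinity>)" if "j < ?n + 2" for j
    using that i \<open>a \<noteq> \<infinity>\<close> by (auto simp: bordered_def z)
  have dim: "dim_col ?M = ?n + 2" by (simp add: bordered_def)
  then have pos: "0 < dim_col ?M" by simp
  show "trop_row ?M z i \<le> max (trop_row M x i) (v $ i + s)"
    unfolding trop_row_le_iff[OF pos]
    using trop_row_le_iff[OF \<open>0 < ?n\<close>, of x i "trop_row M x i"]
    by (auto simp: entry dim le_max_iff_disj)
  show "max (trop_row M x i) (v $ i + s) \<le> trop_row ?M z i"
  proof (rule max.boundedI)
    show "v $ i + s \<le> trop_row ?M z i"
      unfolding le_trop_row_iff[OF pos] by (rule exI[of _ ?n]) (simp add: entry dim)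
    show "trop_row M x i \<le> trop_row ?M z i"
      unfolding trop_row_le_iff[OF \<open>0 < ?n\<close>]
    proof (intro allI impI)
      fix j assume "j < ?n"
      then have "M $$ (i, j) + x $ j = ?M $$ (i, j) + z $ j" "j < dim_col ?M"
        using entry[of j] dim by simp_all
      then show "M $$ (i, j) + x $ j \<le> trop_row ?M z i"
        unfolding le_trop_row_iff[OF pos] by auto
    qed
  qed
qed

text \<open>
  A point \<open>y\<close> of the polyhedron gives the solution \<open>(y, 0, -\<infinity>)\<close> of the homogeneous system. Conversely the
  sink entry of a solution is \<open>-\<infinity>\<close>, and subtracting the finite homogenising entry \<open>s\<close> from the other
  entries gives a point of the polyhedron.
\<close>

lemma game_of_polyhedron_correct:
  assumes P: "P \<in> instances polyhedron_emptiness"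
  shows "game_of_polyhedron P \<in> instances mean_payoff_winning"
    and "tropical_polyhedron P \<noteq> {} \<longleftrightarrow> winning (game_of_polyhedron P)"
proof -
  obtain A B c d m n where P_eq: "P = (A, B, c, d)" and mn: "0 < m" "0 < n"
    and A: "A \<in> trop_mat m n" and B: "B \<in> trop_mat m n" and c: "c \<in> trop_vec m" and d: "d \<in> trop_vec m"
    using P by (auto simp: polyhedron_emptiness_def)
  let ?A = "bordered A c (-\<infinity>) 0" and ?B = "bordered B d 0 (-1)"
  have dim [simp]: "dim_row A = m" "dim_col A = n" "dim_row B = m" "dim_col B = n" "dim_vec c = m" "dim_vec d = m"
    using A B c d by (auto simp: trop_mat_def trop_vec_def)
  interpret bordered_game: game_matrices ?A ?B "m + 2" "n + 2"
  proof
    show "?A \<in> trop_mat (m + 2) (n + 2)" "?B \<in> trop_mat (m + 2) (n + 2)"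
      by (rule bordered_trop_mat[OF A c] bordered_trop_mat[OF B d]; simp add: one_ereal_def)+
    show "\<exists>i<m + 2. ?A $$ (i, j) \<noteq> -\<infinity>" if "j < n + 2" for j
      using that by (intro exI[of _ "Suc m"]) (simp add: bordered_def)
    show "\<exists>j<n + 2. ?B $$ (i, j) \<noteq> -\<infinity>" if "i < m + 2" for i
      using that by (intro exI[of _ "Suc n"]) (simp add: bordered_def)
  qed
  have game: "game_of_polyhedron P = (?A, ?B, n)" by (simp add: game_of_polyhedron_def P_eq)
  show "game_of_polyhedron P \<in> instances mean_payoff_winning"
  proof -
    have "0 < m + 2 \<and> 0 < n + 2 \<and> ?A \<in> trop_mat (m + 2) (n + 2) \<and> ?B \<in> trop_mat (m + 2) (n + 2) \<and>
        (\<forall>j<n + 2. \<exists>i<m + 2. ?A $$ (i, j) \<noteq> -\<infinity>) \<and> (\<forall>i<m + 2. \<exists>j<n + 2. ?B $$ (i, j) \<noteq> -\<infinity>) \<and> n < n + 2"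
      using bordered_game.A bordered_game.B bordered_game.columns bordered_game.rows by simp
    then show ?thesis unfolding game mean_payoff_winning_def decision_problem.simps mem_Collect_eq case_prod_conv by blast
  qed
  have row: "trop_row ?A x i \<le> trop_row ?B x i \<longleftrightarrow>
      max (trop_row A y i) (c $ i + s) \<le> max (trop_row B y i) (d $ i + s)"
    if "i < m" "y \<in> carrier_vec n"
      "x = vec (n + 2) (\<lambda>j. if j < n then y $ j else if j = n then s else -\<infinity>)" for x y s i
  proof -
    have "trop_row ?A x i = max (trop_row A y i) (c $ i + s)"
      by (rule trop_row_bordered, unfold dim) (use that mn in simp_all)
    moreover have "trop_row ?B x i = max (trop_row B y i) (d $ i + s)"
      by (rule trop_row_bordered, unfold dim) (use that mn in simp_all)
    ultimately show ?thesis by (simp only:)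
  qed
  have "tropical_polyhedron P \<noteq> {} \<longleftrightarrow> (\<exists>x\<in>homogeneous_cone ?A ?B. x $ n \<noteq> -\<infinity>)"
  proof
    assume "tropical_polyhedron P \<noteq> {}"
    then obtain y where y: "y \<in> trop_vec n"
      "\<And>i. i < m \<Longrightarrow> max (trop_row A y i) (c $ i) \<le> max (trop_row B y i) (d $ i)"
      by (auto simp: tropical_polyhedron_def P_eq)
    define x where "x = vec (n + 2) (\<lambda>j. if j < n then y $ j else if j = n then 0 else -\<infinity>)"
    have "x \<in> trop_vec (n + 2)" using y(1) by (auto simp: x_def trop_vec_def)
    moreover have "trop_row ?A x i \<le> trop_row ?B x i" if i: "i < m + 2" for i
    proof -
      consider "i < m" | "i = m" | "i = Suc m" using i by linarith
      then show ?thesis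
      proof cases
        case 1
        then show ?thesis using row[OF 1 _ x_def] y(1) y(2)[OF 1] by (simp add: trop_vec_def del: max.bounded_iff)
      next
        case 2
        have "?A $$ (i, j) + x $ j = -\<infinity>" if "j < n + 2" for j
          using that y(1) 2 by (auto simp: bordered_def x_def trop_vec_def)
        then have "?A $$ (i, j) + x $ j \<le> trop_row ?B x i" if "j < n + 2" for j
          using that by (simp only: ereal_less_eq)
        then show ?thesis by (subst trop_row_le_iff) simp_all
      next
        case 3
        then have "trop_row ?A x i = trop_row ?B x i"
          unfolding trop_row_def by (intro arg_cong[where f = Max] image_cong) (auto simp: bordered_def)
        then show ?thesis by simp
      qed
    qed
    ultimately have "x \<in> homogeneous_cone ?A ?B" by (simp add: homogeneous_cone_def)
    moreover have "x $ n \<noteq> -\<infinity>" by (simp add: x_def)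
    ultimately show "\<exists>x\<in>homogeneous_cone ?A ?B. x $ n \<noteq> -\<infinity>" by blast
  next
    assume "\<exists>x\<in>homogeneous_cone ?A ?B. x $ n \<noteq> -\<infinity>"
    then obtain x where x: "x \<in> trop_vec (n + 2)" "x $ n \<noteq> -\<infinity>"
      and le: "\<And>i. i < m + 2 \<Longrightarrow> trop_row ?A x i \<le> trop_row ?B x i"
      by (auto simp: homogeneous_cone_def)
    have top: "x $ j \<noteq> \<infinity>" if "j < n + 2" for j using x that by (simp add: trop_vec_def)
    obtain s where s: "x $ n = ereal s" using x top[of n] by (cases "x $ n") auto
    have last: "x $ Suc n = -\<infinity>"
    proof (rule ccontr)
      assume fin: "x $ Suc n \<noteq> -\<infinity>"
      have "?A $$ (m, Suc n) + x $ Suc n \<le> trop_row ?B x m"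
        using le[of m] trop_row_le_iff[of ?A x m "trop_row ?B x m"] by simp
      \<comment> \<open>the sink row of \<open>B\<close> offers only \<open>-\<infinity>\<close> and \<open>x\<^sub>s - 1\<close>\<close>
      then obtain k where k: "k < n + 2" "x $ Suc n \<le> ?B $$ (m, k) + x $ k"
        by (subst (asm) le_trop_row_iff) (auto simp: bordered_def)
      have entry: "?B $$ (m, k) = (if k \<le> n then -\<infinity> else ereal (-1))"
        using k(1) by (simp add: bordered_def one_ereal_def)
      obtain u where u: "x $ Suc n = ereal u" using fin top[of "Suc n"] by (cases "x $ Suc n") auto
      show False
      proof (cases "k \<le> n")
        case True
        then show False using k u top[of k] by (cases "x $ k") (simp_all add: entry)
      next
        case False
        then have "k = Suc n" using k(1) by simp
        then show False using k u entry by simp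
      qed
    qed
    define y where "y = vec n (\<lambda>j. x $ j)"
    have x_eq: "x = vec (n + 2) (\<lambda>j. if j < n then y $ j else if j = n then ereal s else -\<infinity>)"
    proof (rule eq_vecI)
      fix j assume "j < dim_vec (vec (n + 2) (\<lambda>j. if j < n then y $ j else if j = n then ereal s else -\<infinity>))"
      then consider "j < n" | "j = n" | "j = Suc n" by fastforce
      then show "x $ j = vec (n + 2) (\<lambda>j. if j < n then y $ j else if j = n then ereal s else -\<infinity>) $ j"
        by cases (auto simp: y_def s last)
    qed (use x in \<open>simp add: trop_vec_def\<close>)
    define z where "z = vec n (\<lambda>j. y $ j + ereal (- s))"
    have shift: "trop_row A z i = trop_row A y i + ereal (- s)" "trop_row B z i = trop_row B y i + ereal (- s)" for i
      using trop_row_shift[of A y "- s" i] trop_row_shift[of B y "- s" i] mn by (auto simp: z_def y_def)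
    have "max (trop_row A z i) (c $ i) \<le> max (trop_row B z i) (d $ i)" if i: "i < m" for i
    proof -
      have le': "max (trop_row A y i) (c $ i + ereal s) \<le> max (trop_row B y i) (d $ i + ereal s)"
        using row[OF i _ x_eq] le[of i] i by (simp add: y_def del: max.bounded_iff)
      have un: "(v + ereal s) + ereal (- s) = v" for v by (cases v) auto
      have max: "max u v + ereal (- s) = max (u + ereal (- s)) (v + ereal (- s))" for u v
        using max_of_mono[of "\<lambda>u. u + ereal (- s)" u v] by (simp add: monoI add_right_mono)
      show ?thesis using add_right_mono[OF le', of "ereal (- s)"] by (simp only: max un shift)
    qed
    moreover have "z \<in> trop_vec n" using top by (auto simp: z_def y_def trop_vec_def)
    ultimately have "z \<in> tropical_polyhedron P" by (simp add: tropical_polyhedron_def P_eq)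
    then show "tropical_polyhedron P \<noteq> {}" by blast
  qed
  then show "tropical_polyhedron P \<noteq> {} \<longleftrightarrow> winning (game_of_polyhedron P)"
    using bordered_game.winning_iff_cone[of n] by (simp add: game)
qed

lemma polyhedron_of_game_correct:
  assumes G: "G \<in> instances mean_payoff_winning"
  shows "polyhedron_of_game G \<in> instances polyhedron_emptiness"
    and "winning G \<longleftrightarrow> tropical_polyhedron (polyhedron_of_game G) \<noteq> {}"
proof -
  obtain A B r m n where G_eq: "G = (A, B, r)" and mn: "0 < m" "0 < n" and r: "r < n"
    and AB: "A \<in> trop_mat m n" "B \<in> trop_mat m n"
      "\<And>j. j < n \<Longrightarrow> \<exists>i<m. A $$ (i, j) \<noteq> -\<infinity>" "\<And>i. i < m \<Longrightarrow> \<exists>j<n. B $$ (i, j) \<noteq> -\<infinity>"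
    using G by (auto simp: mean_payoff_winning_def)
  interpret game_matrices A B m n by standard (fact AB)+
  define A' where "A' = mat (Suc m) n (\<lambda>(i, j). if i < m then A $$ (i, j) else -\<infinity>)"
  define B' where "B' = mat (Suc m) n (\<lambda>(i, j). if i < m then B $$ (i, j) else if j = r then 0 else -\<infinity>)"
  define c where "c = vec (Suc m) (\<lambda>i. if i < m then -\<infinity> else (0::ereal))"
  define d where "d = vec (Suc m) (\<lambda>_. -\<infinity> :: ereal)"
  have poly: "polyhedron_of_game G = (A', B', c, d)"
    by (simp add: polyhedron_of_game_def G_eq A'_def B'_def c_def d_def)
  show "polyhedron_of_game G \<in> instances polyhedron_emptiness"
  proof -
    have "0 < Suc m \<and> 0 < n \<and> A' \<in> trop_mat (Suc m) n \<and> B' \<in> trop_mat (Suc m) n \<and>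
        c \<in> trop_vec (Suc m) \<and> d \<in> trop_vec (Suc m)"
      using A B mn by (auto simp: trop_mat_def trop_vec_def A'_def B'_def c_def d_def)
    then show ?thesis unfolding poly polyhedron_emptiness_def decision_problem.simps mem_Collect_eq case_prod_conv by blast
  qed
  have row: "trop_row A' x i = trop_row A x i" "trop_row B' x i = trop_row B x i" if "i < m" for x i
    using that unfolding trop_row_def
    by (auto simp: A'_def B'_def intro!: arg_cong[where f = Max] image_cong)
  have last: "0 \<le> trop_row B' x m \<longleftrightarrow> 0 \<le> x $ r" if "x \<in> trop_vec n" for x
  proof -
    have entry: "B' $$ (m, j) + x $ j = (if j = r then x $ r else -\<infinity>)" if "j < n" for j
      using that \<open>x \<in> trop_vec n\<close> by (auto simp: B'_def trop_vec_def)
    have dim: "dim_col B' = n" by (simp add: B'_def)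
    then have "0 \<le> trop_row B' x m \<longleftrightarrow> (\<exists>j<n. 0 \<le> B' $$ (m, j) + x $ j)"
      using mn by (subst le_trop_row_iff) auto
    also have "\<dots> \<longleftrightarrow> 0 \<le> x $ r" using r by (auto simp: entry split: if_splits)
    finally show ?thesis .
  qed
  have first: "trop_row A' x m = -\<infinity>" if "x \<in> trop_vec n" for x
  proof -
    have "trop_row A' x m \<le> -\<infinity>"
      using that mn by (subst trop_row_le_iff) (auto simp: A'_def trop_vec_def)
    then show ?thesis by simp
  qed
  have poly_iff: "x \<in> tropical_polyhedron (polyhedron_of_game G) \<longleftrightarrow>
      x \<in> homogeneous_cone A B \<and> 0 \<le> x $ r" for x
  proof (cases "x \<in> trop_vec n")
    case True
    have "(\<forall>i<Suc m. max (trop_row A' x i) (c $ i) \<le> max (trop_row B' x i) (d $ i)) \<longleftrightarrow>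
        (\<forall>i<m. trop_row A x i \<le> trop_row B x i) \<and> 0 \<le> x $ r"
      using last[OF True] first[OF True] by (auto simp: All_less_Suc row c_def d_def max_absorb1)
    then show ?thesis using True
      by (simp add: poly tropical_polyhedron_def homogeneous_cone_def) (simp add: A'_def)
  next
    case False
    then show ?thesis by (simp add: poly tropical_polyhedron_def homogeneous_cone_def A'_def)
  qed
  show "winning G \<longleftrightarrow> tropical_polyhedron (polyhedron_of_game G) \<noteq> {}"
    unfolding G_eq winning_iff_cone[OF r]
  proof
    assume "\<exists>x\<in>homogeneous_cone A B. x $ r \<noteq> -\<infinity>"
    then obtain x where x: "x \<in> homogeneous_cone A B" "x $ r \<noteq> -\<infinity>" by blast
    then have xn: "x \<in> trop_vec n" by (simp add: homogeneous_cone_def)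
    then obtain s where s: "x $ r = ereal s" using x(2) r by (cases "x $ r") (auto simp: trop_vec_def)
    define y where "y = vec n (\<lambda>j. x $ j + ereal (- s))"
    have "y \<in> trop_vec n" using xn by (auto simp: y_def trop_vec_def)
    moreover have "trop_row A y i = trop_row A x i + ereal (- s)" "trop_row B y i = trop_row B x i + ereal (- s)" for i
      using trop_row_shift[of A x "- s" i] trop_row_shift[of B x "- s" i] mn xn by (auto simp: y_def trop_vec_def)
    ultimately have "y \<in> homogeneous_cone A B"
      using x(1) by (auto simp: homogeneous_cone_def intro: add_right_mono)
    moreover have "0 \<le> y $ r" using r s by (simp add: y_def)
    ultimately show "tropical_polyhedron (polyhedron_of_game (A, B, r)) \<noteq> {}"
      using poly_iff[of y] by (auto simp: G_eq)
  next
    assume "tropical_polyhedron (polyhedron_of_game (A, B, r)) \<noteq> {}"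
    then obtain x where x: "x \<in> homogeneous_cone A B" "0 \<le> x $ r" using poly_iff by (auto simp: G_eq)
    then have "x $ r \<noteq> -\<infinity>" by auto
    with x(1) show "\<exists>x\<in>homogeneous_cone A B. x $ r \<noteq> -\<infinity>" by blast
  qed
qed

section \<open>A calculus of running times\<close>

text \<open>
  Jump targets are absolute, so a piece of code is a function of the address at which it is placed.
\<close>

type_synonym code = "nat \<Rightarrow> instr list"
type_synonym config = "(nat \<Rightarrow> nat) \<times> nat list \<times> ereal list"

text \<open>
  Correctness with the exact running time. The weight memory is left unspecified on both sides: each weight
  is written to the output immediately after it has been produced in cell 0, so nothing there has to be
  remembered.
\<close>

definition runs :: "data \<Rightarrow> code \<Rightarrow> nat \<Rightarrow> config \<Rightarrow> config \<Rightarrow> bool" where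
  "runs inp c t = (\<lambda>(\<nu>, ns, ws) (\<nu>', ns', ws').
     \<forall>us vs \<omega>. \<exists>\<omega>'. let l = length us in
       (step (us @ c l @ vs) inp ^^ t) \<lparr>pc = l, nmem = \<nu>, wmem = \<omega>, nout = ns, wout = ws\<rparr> =
         \<lparr>pc = l + length (c l), nmem = \<nu>', wmem = \<omega>', nout = ns', wout = ws'\<rparr>)"

definition instrs :: "instr list \<Rightarrow> code" where
  "instrs is = (\<lambda>_. is)"

definition seq :: "code \<Rightarrow> code \<Rightarrow> code" (infixr ";;" 60) where
  "(c ;; d) = (\<lambda>l. c l @ d (l + length (c l)))"

text \<open>
  Runs \<open>c\<close> as often as the counter \<open>R\<close> says, counting \<open>R\<close> down to 0. The registers 0 and 1 are reserved
  for the constants 0 and 1; the comparison of register 0 with itself is an unconditional jump.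
\<close>

definition for_loop :: "nat \<Rightarrow> code \<Rightarrow> code" where
  "for_loop R c = (\<lambda>l. NJumpLe R 0 (l + length (c (Suc l)) + 3) #
     c (Suc l) @ [NSub R R 1, NJumpLe 0 0 l])"

lemma step_at: "pc s = length us \<Longrightarrow> step (us @ i # vs) inp s = exec inp i s"
  by (simp add: step_def)

lemma funpow_add_apply: "(f ^^ (m + n)) x = (f ^^ n) ((f ^^ m) x)"
  by (simp add: add.commute[of m] funpow_add)

lemma runs_seq:
  assumes "runs inp c t C C'" "runs inp d t' C' C''"
  shows "runs inp (c ;; d) (t + t') C C''"
proof -
  obtain \<nu> ns ws \<nu>' ns' ws' \<nu>'' ns'' ws'' where C: "C = (\<nu>, ns, ws)" "C' = (\<nu>', ns', ws')" "C'' = (\<nu>'', ns'', ws'')"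
    by (metis prod_cases3)
  show ?thesis
    unfolding runs_def C Let_def case_prod_conv
  proof (intro allI)
    fix us vs :: "instr list" and \<omega>
    let ?l = "length us"
    let ?d = "d (?l + length (c ?l))"
    let ?p = "us @ (c ;; d) ?l @ vs"
    obtain \<omega>' where 1: "(step (us @ c ?l @ ?d @ vs) inp ^^ t)
        \<lparr>pc = ?l, nmem = \<nu>, wmem = \<omega>, nout = ns, wout = ws\<rparr> =
        \<lparr>pc = ?l + length (c ?l), nmem = \<nu>', wmem = \<omega>', nout = ns', wout = ws'\<rparr>"
      using assms(1) unfolding runs_def C Let_def case_prod_conv by meson
    obtain \<omega>'' where 2: "(step ((us @ c ?l) @ ?d @ vs) inp ^^ t')
        \<lparr>pc = ?l + length (c ?l), nmem = \<nu>', wmem = \<omega>', nout = ns', wout = ws'\<rparr> =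
        \<lparr>pc = ?l + length (c ?l) + length ?d, nmem = \<nu>'', wmem = \<omega>'', nout = ns'', wout = ws''\<rparr>"
      using assms(2)[unfolded runs_def C Let_def case_prod_conv, rule_format, of "us @ c ?l" vs \<omega>'] by auto
    show "\<exists>\<omega>''. (step ?p inp ^^ (t + t')) \<lparr>pc = ?l, nmem = \<nu>, wmem = \<omega>, nout = ns, wout = ws\<rparr> =
        \<lparr>pc = ?l + length ((c ;; d) ?l), nmem = \<nu>'', wmem = \<omega>'', nout = ns'', wout = ws''\<rparr>"
      using 1 2 by (auto simp: seq_def funpow_add_apply)
  qed
qed

lemma funpow_1: "((f :: 'a \<Rightarrow> 'a) ^^ 1) x = f x"
  by simp

text \<open>
  The configuration before round \<open>i\<close> is \<open>(\<nu> i, ns i, ws i)\<close>. A round costs 3 steps besides the body: the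
  test, the decrement and the jump back; the final test costs 1 more.
\<close>

lemma runs_for_loop:
  assumes body: "\<And>i. i < k \<Longrightarrow> runs inp c t (\<nu> i, ns i, ws i) (\<nu>' i, ns (Suc i), ws (Suc i))"
    and count: "\<And>i. i \<le> k \<Longrightarrow> \<nu> i R = k - i"
    and zero: "\<And>i. i \<le> k \<Longrightarrow> \<nu> i 0 = 0"
    and decr: "\<And>i. i < k \<Longrightarrow> \<nu> (Suc i) = (\<nu>' i)(R := \<nu>' i R - \<nu>' i 1)"
    and "R \<noteq> 0"
  shows "runs inp (for_loop R c) (k * (t + 3) + 1) (\<nu> 0, ns 0, ws 0) (\<nu> k, ns k, ws k)"
  unfolding runs_def Let_def case_prod_conv
proof (intro allI)
  fix us vs :: "instr list" and \<omega>
  let ?l = "length us"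
  let ?c = "c (Suc ?l)"
  let ?exit = "?l + length ?c + 3"
  let ?tail = "[NSub R R 1, NJumpLe 0 0 ?l]"
  define p where "p = us @ NJumpLe R 0 ?exit # ?c @ ?tail @ vs"
  let ?s = "\<lambda>l i \<omega>. \<lparr>pc = l, nmem = \<nu> i, wmem = \<omega>, nout = ns i, wout = ws i\<rparr>"
  have iter: "\<exists>\<omega>'. (step p inp ^^ (t + 3)) (?s ?l i \<omega>) = ?s ?l (Suc i) \<omega>'" if i: "i < k" for i \<omega>
  proof -
    have enter: "step p inp (?s ?l i \<omega>) = ?s (Suc ?l) i \<omega>"
      using count[of i] zero[of i] i unfolding p_def by (subst step_at) auto
    obtain \<omega>' where c: "(step p inp ^^ t) (?s (Suc ?l) i \<omega>) =
        \<lparr>pc = Suc ?l + length ?c, nmem = \<nu>' i, wmem = \<omega>', nout = ns (Suc i), wout = ws (Suc i)\<rparr>"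
      using body[OF i, unfolded runs_def Let_def case_prod_conv, rule_format,
          of "us @ [NJumpLe R 0 ?exit]" "?tail @ vs" \<omega>] by (auto simp: p_def)
    have dec: "step p inp \<lparr>pc = Suc ?l + length ?c, nmem = \<nu>' i, wmem = \<omega>', nout = ns (Suc i), wout = ws (Suc i)\<rparr>
        = ?s (Suc (Suc ?l + length ?c)) (Suc i) \<omega>'"
      using step_at[of _ "us @ NJumpLe R 0 ?exit # ?c" "NSub R R 1" "NJumpLe 0 0 ?l # vs"] decr[OF i] by (simp add: p_def)
    have jump: "step p inp (?s (Suc (Suc ?l + length ?c)) (Suc i) \<omega>') = ?s ?l (Suc i) \<omega>'"
      using step_at[of _ "us @ NJumpLe R 0 ?exit # ?c @ [NSub R R 1]" "NJumpLe 0 0 ?l" vs] by (simp add: p_def)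
    have "(step p inp ^^ (1 + t + 1 + 1)) (?s ?l i \<omega>) = ?s ?l (Suc i) \<omega>'"
      by (simp only: funpow_add_apply enter c dec jump funpow_1)
    moreover have "1 + t + 1 + 1 = t + 3" by simp
    ultimately show ?thesis by metis
  qed
  have "\<exists>\<omega>'. (step p inp ^^ (i * (t + 3))) (?s ?l 0 \<omega>) = ?s ?l i \<omega>'" if "i \<le> k" for i
    using that
  proof (induction i)
    case (Suc i)
    then obtain \<omega>' where "(step p inp ^^ (i * (t + 3))) (?s ?l 0 \<omega>) = ?s ?l i \<omega>'" by auto
    then show ?case using iter[of i \<omega>'] Suc.prems
      by (simp only: mult_Suc add.commute[of "t + 3"] funpow_add_apply Suc_le_lessD)
  qed simp
  then obtain \<omega>' where "(step p inp ^^ (k * (t + 3))) (?s ?l 0 \<omega>) = ?s ?l k \<omega>'" by blast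
  moreover have "step p inp (?s ?l k \<omega>') = ?s ?exit k \<omega>'"
    using count[of k] zero[of k] unfolding p_def by (subst step_at) auto
  ultimately show "\<exists>\<omega>'. (step (us @ for_loop R c ?l @ vs) inp ^^ (k * (t + 3) + 1))
      \<lparr>pc = ?l, nmem = \<nu> 0, wmem = \<omega>, nout = ns 0, wout = ws 0\<rparr> =
      \<lparr>pc = ?l + length (for_loop R c ?l), nmem = \<nu> k, wmem = \<omega>', nout = ns k, wout = ws k\<rparr>"
    by (auto simp: for_loop_def p_def)
qed

lemma runs_computes_within:
  assumes "runs inp c t (\<lambda>_. 0, [], []) (\<nu>, out)" and "t \<le> T"
  shows "computes_within (c 0) inp T out"
proof -
  obtain ns ws where out: "out = (ns, ws)" by fastforce
  obtain \<omega> where *: "(step (c 0) inp ^^ t) initial_state =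
      \<lparr>pc = length (c 0), nmem = \<nu>, wmem = \<omega>, nout = fst out, wout = snd out\<rparr>" (is "_ = ?s")
    using assms(1)[unfolded out runs_def Let_def case_prod_conv, rule_format, of "[]" "[]" "\<lambda>_. 0"]
    by (auto simp: initial_state_def out)
  have "(step (c 0) inp ^^ u) ?s = ?s" for u
    by (induction u) (auto simp: step_def)
  then have "(step (c 0) inp ^^ T) initial_state = ?s"
    using funpow_add_apply[of t "T - t" "step (c 0) inp" initial_state] assms(2) * by simp
  then show ?thesis by (simp add: computes_within_def)
qed

text \<open>
  A register file given by the list of its first entries, a normal form on which the simplifier can execute
  code symbolically.
\<close>

definition regs :: "nat list \<Rightarrow> nat \<Rightarrow> nat" where
  "regs xs a = (if a < length xs then xs ! a else 0)"

lemma regs_update: "a < length xs \<Longrightarrow> (regs xs)(a := v) = regs (xs[a := v])"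
  by (auto simp: regs_def fun_eq_iff nth_list_update)

lemma regs_zero: "(\<lambda>_. 0) = regs (replicate n 0)"
  by (auto simp: regs_def fun_eq_iff)

fun run_nat :: "nat list \<Rightarrow> instr \<Rightarrow> (nat \<Rightarrow> nat) \<times> nat list \<Rightarrow> (nat \<Rightarrow> nat) \<times> nat list" where
  "run_nat inp (NConst a k) (\<nu>, ns) = (\<nu>(a := k), ns)"
| "run_nat inp (NAdd a b c) (\<nu>, ns) = (\<nu>(a := \<nu> b + \<nu> c), ns)"
| "run_nat inp (NSub a b c) (\<nu>, ns) = (\<nu>(a := \<nu> b - \<nu> c), ns)"
| "run_nat inp (NRead a b) (\<nu>, ns) = (\<nu>(a := input_at inp (\<nu> b)), ns)"
| "run_nat inp (NWrite a) (\<nu>, ns) = (\<nu>, ns @ [\<nu> a])"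
| "run_nat inp _ C = C"

fun nat_instr :: "instr \<Rightarrow> bool" where
  "nat_instr (NConst a k) = True"
| "nat_instr (NAdd a b c) = True"
| "nat_instr (NSub a b c) = True"
| "nat_instr (NRead a b) = True"
| "nat_instr (NWrite a) = True"
| "nat_instr _ = False"

lemma runs_nil: "runs inp (instrs []) 0 C C"
  by (cases C) (auto simp: runs_def instrs_def)

lemma runs_nat_instr:
  assumes "nat_instr i" "run_nat (fst inp) i (\<nu>, ns) = (\<nu>', ns')"
  shows "runs inp (instrs [i]) 1 (\<nu>, ns, ws) (\<nu>', ns', ws)"
  using assms by (cases i) (auto simp: runs_def instrs_def step_at)

lemma instrs_Cons: "instrs (i # is) = instrs [i] ;; instrs is"
  by (simp add: instrs_def seq_def)

lemma runs_nat_instrs: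
  assumes "list_all nat_instr is" "fold (run_nat (fst inp)) is (\<nu>, ns) = (\<nu>', ns')"
  shows "runs inp (instrs is) (length is) (\<nu>, ns, ws) (\<nu>', ns', ws)"
  using assms
proof (induction "is" arbitrary: \<nu> ns)
  case Nil
  then show ?case by (simp add: runs_nil)
next
  case (Cons i "is")
  obtain \<nu>1 ns1 where 1: "run_nat (fst inp) i (\<nu>, ns) = (\<nu>1, ns1)" by fastforce
  have "runs inp (instrs [i] ;; instrs is) (1 + length is) (\<nu>, ns, ws) (\<nu>', ns', ws)"
    by (rule runs_seq[OF runs_nat_instr[OF _ 1] Cons.IH]) (use Cons.prems 1 in auto)
  then show ?case by (simp add: instrs_Cons[of i "is"])
qed

text \<open>
  The weight constants of a program are rational or \<open>-\<infinity>\<close>; the latter is represented by \<open>None\<close>.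
\<close>

fun put_const :: "rat option \<Rightarrow> code" where
  "put_const None = instrs [WMinusInf 0, WWrite 0]"
| "put_const (Some q) = instrs [WConst 0 q, WWrite 0]"

fun const_weight :: "rat option \<Rightarrow> ereal" where
  "const_weight None = -\<infinity>"
| "const_weight (Some q) = ereal (real_of_rat q)"

text \<open>
  Copies the input weight at the position in register \<open>a\<close> to the output and advances that position.
\<close>

definition put_input :: "nat \<Rightarrow> code" where
  "put_input a = instrs [WRead 0 a, WWrite 0, NAdd a a 1]"

lemma runs_put_const: "runs inp (put_const x) 2 (\<nu>, ns, ws) (\<nu>, ns, ws @ [const_weight x])"
proof -
  have "step (us @ i # j # vs) inp (step (us @ i # j # vs) inp s) = exec inp j (exec inp i s)"
    if "pc s = length us" "pc (exec inp i s) = Suc (length us)" for us i j vs s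
    using that step_at[of _ "us @ [i]" j vs inp] by (simp add: step_at)
  then show ?thesis
    by (cases x) (auto simp: runs_def instrs_def numeral_2_eq_2)
qed

lemma runs_put_input:
  assumes "\<nu> 1 = 1"
  shows "runs inp (put_input a) 3 (\<nu>, ns, ws) (\<nu>(a := \<nu> a + 1), ns, ws @ [input_at (snd inp) (\<nu> a)])"
proof -
  have "step (us @ i # j # k # vs) inp (step (us @ i # j # k # vs) inp (step (us @ i # j # k # vs) inp s))
      = exec inp k (exec inp j (exec inp i s))"
    if "pc s = length us" "pc (exec inp i s) = Suc (length us)"
      "pc (exec inp j (exec inp i s)) = Suc (Suc (length us))" for us i j k vs s
    using that step_at[of _ "us @ [i]" j "k # vs" inp] step_at[of _ "us @ [i,j]" k vs inp]
    by (simp add: step_at)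
  then show ?thesis using assms
    by (auto simp: runs_def instrs_def put_input_def numeral_3_eq_3)
qed

lemma runs_put_consts:
  assumes R: "\<nu> R = k" "R \<noteq> 0" "R \<noteq> 1" and "\<nu> 0 = 0" "\<nu> 1 = 1"
  shows "runs inp (for_loop R (put_const x)) (k * 5 + 1) (\<nu>, ns, ws)
     (\<nu>(R := 0), ns, ws @ replicate k (const_weight x))"
proof -
  have "runs inp (for_loop R (put_const x)) (k * (2 + 3) + 1)
     (\<nu>(R := k - 0), ns, ws @ replicate 0 (const_weight x))
     (\<nu>(R := k - k), ns, ws @ replicate k (const_weight x))"
  proof (rule runs_for_loop[where \<nu>' = "\<lambda>i. \<nu>(R := k - i)"])
    fix i
    show "runs inp (put_const x) 2 (\<nu>(R := k - i), ns, ws @ replicate i (const_weight x))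
        (\<nu>(R := k - i), ns, ws @ replicate (Suc i) (const_weight x))"
      using runs_put_const[of inp x "\<nu>(R := k - i)" ns "ws @ replicate i (const_weight x)"]
      by (simp flip: replicate_append_same)
  qed (use assms in auto)
  moreover have "\<nu>(R := k) = \<nu>" using R(1) by auto
  ultimately show ?thesis by simp
qed

lemma runs_put_inputs:
  assumes R: "\<nu> R = k" "R \<noteq> 0" "R \<noteq> 1" and a: "a \<noteq> R" "a \<noteq> 0" "a \<noteq> 1" and "\<nu> 0 = 0" "\<nu> 1 = 1"
  shows "runs inp (for_loop R (put_input a)) (k * 6 + 1) (\<nu>, ns, ws)
     (\<nu>(R := 0, a := \<nu> a + k), ns, ws @ map (\<lambda>i. input_at (snd inp) (\<nu> a + i)) [0..<k])"
proof -
  let ?ws = "\<lambda>k. ws @ map (\<lambda>i. input_at (snd inp) (\<nu> a + i)) [0..<k]"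
  have "runs inp (for_loop R (put_input a)) (k * (3 + 3) + 1)
     (\<nu>(R := k - 0, a := \<nu> a + 0), ns, ?ws 0) (\<nu>(R := k - k, a := \<nu> a + k), ns, ?ws k)"
  proof (rule runs_for_loop[where \<nu>' = "\<lambda>i. \<nu>(R := k - i, a := \<nu> a + Suc i)"])
    fix i
    show "runs inp (put_input a) 3 (\<nu>(R := k - i, a := \<nu> a + i), ns, ?ws i)
        (\<nu>(R := k - i, a := \<nu> a + Suc i), ns, ?ws (Suc i))"
      using runs_put_input[of "\<nu>(R := k - i, a := \<nu> a + i)" inp a ns "?ws i"] assms by auto
  qed (use assms in \<open>auto simp: fun_upd_twist\<close>)
  moreover have "\<nu>(R := k, a := \<nu> a) = \<nu>" using R(1) by auto
  ultimately show ?thesis by simp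
qed

section \<open>Row by row encoding of matrices\<close>

definition flat :: "nat \<Rightarrow> (nat \<Rightarrow> 'a list) \<Rightarrow> 'a list" where
  "flat k f = concat (map f [0..<k])"

lemma flat_Suc: "flat (Suc k) f = flat k f @ f k"
  by (simp add: flat_def)

lemma length_flat: "(\<And>i. i < k \<Longrightarrow> length (f i) = l) \<Longrightarrow> length (flat k f) = k * l"
  by (induction k) (auto simp: flat_def)

lemma nth_flat:
  "\<lbrakk>\<And>i. i < k \<Longrightarrow> length (f i) = l; i < k; j < l\<rbrakk> \<Longrightarrow> flat k f ! (i * l + j) = f i ! j"
proof (induction k)
  case (Suc k)
  have len: "length (flat k f) = k * l" using Suc.prems by (intro length_flat) auto
  show ?case
  proof (cases "i = k")
    case True
    then show ?thesis by (simp add: flat_Suc nth_append len)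
  next
    case False
    then have "Suc i \<le> k" using Suc.prems by simp
    then have "Suc i * l \<le> k * l" by (rule mult_le_mono1)
    then have "i * l + j < k * l" using \<open>j < l\<close> by simp
    then show ?thesis using False Suc by (simp add: flat_Suc nth_append len)
  qed
qed simp

lemma flat_cong: "(\<And>i. i < k \<Longrightarrow> f i = g i) \<Longrightarrow> flat k f = flat k g"
  by (auto simp: flat_def intro!: arg_cong[where f = concat])

lemma mat_flat: "concat (mat_to_list A) = flat (dim_row A) (\<lambda>i. map (\<lambda>j. A $$ (i, j)) [0..<dim_col A])"
  by (simp add: mat_to_list_def flat_def)

lemma length_mat_to_list: "length (concat (mat_to_list A)) = dim_row A * dim_col A"
  unfolding mat_flat by (rule length_flat) simp

lemma nth_mat_to_list:
  assumes "i < dim_row A" "j < dim_col A"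
  shows "concat (mat_to_list A) ! (i * dim_col A + j) = A $$ (i, j)"
  unfolding mat_flat by (subst nth_flat[where l = "dim_col A"]) (use assms in auto)

lemma input_at_append_left: "k < length xs \<Longrightarrow> input_at (xs @ ys) k = xs ! k"
  by (simp add: input_at_def nth_append)

lemma input_at_append_right: "input_at (xs @ ys) (length xs + k) = input_at ys k"
  by (simp add: input_at_def nth_append)

lemma input_at_matrix:
  assumes "i < dim_row A" "j < dim_col A" "length us = p"
  shows "input_at (us @ concat (mat_to_list A) @ vs) (p + (i * dim_col A + j)) = A $$ (i, j)"
proof -
  have "Suc i * dim_col A \<le> dim_row A * dim_col A" using assms by (intro mult_le_mono1) simp
  then have "i * dim_col A + j < length (concat (mat_to_list A))"
    using assms by (simp add: length_mat_to_list)
  then show ?thesis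
    using assms(1,2) by (simp only: assms(3)[symmetric] input_at_append_right input_at_append_left nth_mat_to_list)
qed

lemma input_at_vector:
  assumes "i < dim_vec v" "length us = p"
  shows "input_at (us @ list_of_vec v @ vs) (p + i) = v $ i"
  using assms by (simp only: assms(2)[symmetric] input_at_append_right)
    (simp add: input_at_append_left)

lemma flat_bordered:
  "concat (mat_to_list (bordered M v x y)) =
     flat (dim_row M) (\<lambda>i. map (\<lambda>j. M $$ (i, j)) [0..<dim_col M] @ [v $ i, x])
     @ replicate (dim_col M + 1) (-\<infinity>) @ [y] @ replicate (dim_col M + 2) 0"
proof -
  let ?m = "dim_row M" and ?n = "dim_col M"
  let ?row = "\<lambda>i. map (\<lambda>j. bordered M v x y $$ (i, j)) [0..<?n + 2]"
  have "?row i = map (\<lambda>j. M $$ (i, j)) [0..<?n] @ [v $ i, x]" if "i < ?m" for i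
    using that by (auto simp: bordered_def)
  then have top: "flat ?m ?row = flat ?m (\<lambda>i. map (\<lambda>j. M $$ (i, j)) [0..<?n] @ [v $ i, x])"
    by (rule flat_cong)
  have "?row ?m = map (\<lambda>_. -\<infinity>) [0..<?n + 1] @ [y]"
    by (auto simp: bordered_def)
  then have middle: "?row ?m = replicate (?n + 1) (-\<infinity>) @ [y]"
    by (simp only: map_replicate_const length_upt minus_nat.diff_0)
  have "?row (Suc ?m) = map (\<lambda>_. 0) [0..<?n + 2]"
    by (rule map_cong) (auto simp: bordered_def)
  then have bottom: "?row (Suc ?m) = replicate (?n + 2) 0"
    by (simp only: map_replicate_const length_upt minus_nat.diff_0)
  have "concat (mat_to_list (bordered M v x y)) = flat (Suc (Suc ?m)) ?row"
    unfolding mat_flat dim_bordered by simp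
  then show ?thesis by (simp only: flat_Suc top middle bottom append_assoc)
qed

section \<open>The two programs\<close>

lemmas regs_simps = regs_def regs_update

text \<open>
  Register 2 holds \<open>m\<close>, register 3 holds \<open>n\<close>, register 4 is the position in the input of the next entry of
  the matrix, register 5 that of the next entry of the vector; 6 and 7 are loop counters.
\<close>

definition put_bordered :: "rat option \<Rightarrow> rat option \<Rightarrow> code" where
  "put_bordered x y =
     instrs [NAdd 6 2 0] ;;
     for_loop 6 (instrs [NAdd 7 3 0] ;; for_loop 7 (put_input 4) ;; put_input 5 ;; put_const x) ;;
     instrs [NAdd 7 3 1] ;; for_loop 7 (put_const None) ;; put_const y ;;
     instrs [NAdd 7 3 1, NAdd 7 7 1] ;; for_loop 7 (put_const (Some 0))"

text \<open>
  Both matrices precede both vectors in the input, so register 5 starts at \<open>2 * m * n\<close>, which is computed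
  by repeated addition. After the first bordered matrix both positions already point to the data of the
  second one.
\<close>

definition game_program :: code where
  "game_program =
     instrs [NConst 1 1, NRead 2 0, NRead 3 1, NConst 7 2, NAdd 6 2 7, NWrite 6, NAdd 6 3 7, NWrite 6,
       NWrite 3, NAdd 6 2 0] ;;
     for_loop 6 (instrs [NAdd 5 5 3, NAdd 5 5 3]) ;;
     put_bordered None (Some 0) ;; put_bordered (Some 0) (Some (-1))"

definition put_matrix :: code where
  "put_matrix =
     instrs [NAdd 6 2 0] ;; for_loop 6 (instrs [NAdd 7 3 0] ;; for_loop 7 (put_input 4))"

text \<open>
  Register 5 holds the initial state \<open>r\<close>, the other registers are used as before. Copying a matrix leaves
  register 4 at the beginning of the next matrix.
\<close>

definition polyhedron_program :: code where
  "polyhedron_program =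
     instrs [NConst 1 1, NRead 2 0, NRead 3 1, NAdd 6 1 1, NRead 5 6, NAdd 6 2 1, NWrite 6, NWrite 3] ;;
     put_matrix ;; instrs [NAdd 7 3 0] ;; for_loop 7 (put_const None) ;;
     put_matrix ;; instrs [NAdd 7 5 0] ;; for_loop 7 (put_const None) ;; put_const (Some 0) ;;
     instrs [NSub 7 3 5, NSub 7 7 1] ;; for_loop 7 (put_const None) ;;
     instrs [NAdd 7 2 0] ;; for_loop 7 (put_const None) ;; put_const (Some 0) ;;
     instrs [NAdd 7 2 1] ;; for_loop 7 (put_const None)"

text \<open>
  The last register keeps its initial value when \<open>m = 0\<close>, because then no row sets the inner counter.
\<close>

lemma runs_put_matrix:
  fixes inp :: data and ws :: "ereal list"
  defines "u \<equiv> input_at (snd inp)"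
  shows "runs inp put_matrix (2 + m * (n * 6 + 5))
     (regs [0, 1, m, n, p, r, i0, j0], ns, ws)
     (regs [0, 1, m, n, p + m * n, r, 0, if m = 0 then j0 else 0], ns, ws @ flat m (\<lambda>i. map (\<lambda>j. u (p + (i * n + j))) [0..<n]))"
proof -
  let ?row = "\<lambda>i. map (\<lambda>j. u (p + (i * n + j))) [0..<n]"
  let ?j = "\<lambda>i::nat. if i = 0 then j0 else 0"
  have row: "runs inp (instrs [NAdd 7 3 0] ;; for_loop 7 (put_input 4)) (1 + (n * 6 + 1))
      (regs [0, 1, m, n, p + i * n, r, m - i, ?j i], ns, ws @ flat i ?row)
      (regs [0, 1, m, n, p + Suc i * n, r, m - i, 0], ns, ws @ flat (Suc i) ?row)" for i
  proof (rule runs_seq)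
    show "runs inp (instrs [NAdd 7 3 0]) 1 (regs [0, 1, m, n, p + i * n, r, m - i, ?j i], ns, ws @ flat i ?row)
        (regs [0, 1, m, n, p + i * n, r, m - i, n], ns, ws @ flat i ?row)"
      by (rule runs_nat_instr) (simp_all add: regs_simps)
    show "runs inp (for_loop 7 (put_input 4)) (n * 6 + 1)
        (regs [0, 1, m, n, p + i * n, r, m - i, n], ns, ws @ flat i ?row)
        (regs [0, 1, m, n, p + Suc i * n, r, m - i, 0], ns, ws @ flat (Suc i) ?row)"
      using runs_put_inputs[of "regs [0, 1, m, n, p + i * n, r, m - i, n]" 7 n 4 inp ns "ws @ flat i ?row"]
      by (simp add: regs_simps flat_Suc u_def add.assoc add.commute[of n])
  qed
  have loop: "runs inp (for_loop 6 (instrs [NAdd 7 3 0] ;; for_loop 7 (put_input 4))) (m * (1 + (n * 6 + 1) + 3) + 1)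
      (regs [0, 1, m, n, p + 0 * n, r, m - 0, ?j 0], ns, ws @ flat 0 ?row)
      (regs [0, 1, m, n, p + m * n, r, m - m, ?j m], ns, ws @ flat m ?row)"
    by (rule runs_for_loop[where \<nu> = "\<lambda>i. regs [0, 1, m, n, p + i * n, r, m - i, ?j i]"
          and \<nu>' = "\<lambda>i. regs [0, 1, m, n, p + Suc i * n, r, m - i, 0]"
          and ns = "\<lambda>_. ns" and ws = "\<lambda>i. ws @ flat i ?row"])
       (use row in \<open>auto simp: regs_simps\<close>)
  have "runs inp put_matrix (1 + (m * (1 + (n * 6 + 1) + 3) + 1))
      (regs [0, 1, m, n, p, r, i0, j0], ns, ws)
      (regs [0, 1, m, n, p + m * n, r, m - m, ?j m], ns, ws @ flat m ?row)"
    unfolding put_matrix_def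
  proof (rule runs_seq[OF _ loop])
    show "runs inp (instrs [NAdd 6 2 0]) 1 (regs [0, 1, m, n, p, r, i0, j0], ns, ws)
        (regs [0, 1, m, n, p + 0 * n, r, m - 0, ?j 0], ns, ws @ flat 0 ?row)"
      using runs_nat_instr[of "NAdd 6 2 0" inp "regs [0, 1, m, n, p, r, i0, j0]" ns "regs [0, 1, m, n, p, r, m, j0]" ns ws]
      by (simp add: regs_simps flat_def)
  qed
  then show ?thesis by (simp add: algebra_simps)
qed


lemma runs_put_bordered:
  fixes inp :: data and ws :: "ereal list"
  defines "u \<equiv> input_at (snd inp)"
  shows "runs inp (put_bordered x y) (m * (n * 6 + 10) + n * 10 + 24)
     (regs [0, 1, m, n, p, q, i0, j0], ns, ws)
     (regs [0, 1, m, n, p + m * n, q + m, 0, 0], ns,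
      ws @ flat m (\<lambda>i. map (\<lambda>j. u (p + (i * n + j))) [0..<n] @ [u (q + i), const_weight x])
         @ replicate (n + 1) (-\<infinity>) @ [const_weight y] @ replicate (n + 2) 0)"
proof -
  let ?in = "\<lambda>i. map (\<lambda>j. u (p + (i * n + j))) [0..<n]"
  let ?row = "\<lambda>i. ?in i @ [u (q + i), const_weight x]"
  let ?j = "\<lambda>i::nat. if i = 0 then j0 else 0"
  let ?body = "instrs [NAdd 7 3 0] ;; for_loop 7 (put_input 4) ;; put_input 5 ;; put_const x"
  have row: "runs inp ?body (1 + (n * 6 + 1 + (3 + 2)))
      (regs [0, 1, m, n, p + i * n, q + i, m - i, ?j i], ns, ws @ flat i ?row)
      (regs [0, 1, m, n, p + Suc i * n, q + Suc i, m - i, 0], ns, ws @ flat (Suc i) ?row)" for i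
  proof (intro runs_seq)
    show "runs inp (instrs [NAdd 7 3 0]) 1 (regs [0, 1, m, n, p + i * n, q + i, m - i, ?j i], ns, ws @ flat i ?row)
        (regs [0, 1, m, n, p + i * n, q + i, m - i, n], ns, ws @ flat i ?row)"
      by (rule runs_nat_instr) (simp_all add: regs_simps)
    show "runs inp (for_loop 7 (put_input 4)) (n * 6 + 1)
        (regs [0, 1, m, n, p + i * n, q + i, m - i, n], ns, ws @ flat i ?row)
        (regs [0, 1, m, n, p + Suc i * n, q + i, m - i, 0], ns, ws @ flat i ?row @ ?in i)"
      using runs_put_inputs[of "regs [0, 1, m, n, p + i * n, q + i, m - i, n]" 7 n 4 inp ns "ws @ flat i ?row"]
      by (simp add: regs_simps u_def add.assoc add.commute[of n])
    show "runs inp (put_input 5) 3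
        (regs [0, 1, m, n, p + Suc i * n, q + i, m - i, 0], ns, ws @ flat i ?row @ ?in i)
        (regs [0, 1, m, n, p + Suc i * n, q + Suc i, m - i, 0], ns, ws @ flat i ?row @ ?in i @ [u (q + i)])"
      using runs_put_input[of "regs [0, 1, m, n, p + Suc i * n, q + i, m - i, 0]" inp 5 ns "ws @ flat i ?row @ ?in i"]
      by (simp add: regs_simps u_def)
    show "runs inp (put_const x) 2
        (regs [0, 1, m, n, p + Suc i * n, q + Suc i, m - i, 0], ns, ws @ flat i ?row @ ?in i @ [u (q + i)])
        (regs [0, 1, m, n, p + Suc i * n, q + Suc i, m - i, 0], ns, ws @ flat (Suc i) ?row)"
      using runs_put_const[of inp x "regs [0, 1, m, n, p + Suc i * n, q + Suc i, m - i, 0]" ns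
          "ws @ flat i ?row @ ?in i @ [u (q + i)]"]
      by (simp add: flat_Suc)
  qed
  have loop: "runs inp (for_loop 6 ?body) (m * (1 + (n * 6 + 1 + (3 + 2)) + 3) + 1)
      (regs [0, 1, m, n, p + 0 * n, q + 0, m - 0, ?j 0], ns, ws @ flat 0 ?row)
      (regs [0, 1, m, n, p + m * n, q + m, m - m, ?j m], ns, ws @ flat m ?row)"
    by (rule runs_for_loop[where \<nu> = "\<lambda>i. regs [0, 1, m, n, p + i * n, q + i, m - i, ?j i]"
          and \<nu>' = "\<lambda>i. regs [0, 1, m, n, p + Suc i * n, q + Suc i, m - i, 0]"
          and ns = "\<lambda>_. ns" and ws = "\<lambda>i. ws @ flat i ?row"])
       (use row in \<open>auto simp: regs_simps\<close>)
  let ?r = "\<lambda>j. regs [0, 1, m, n, p + m * n, q + m, 0, j]"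
  let ?w1 = "ws @ flat m ?row"
  let ?w2 = "?w1 @ replicate (n + 1) (-\<infinity>)"
  let ?w3 = "?w2 @ [const_weight y]"
  have "runs inp (put_bordered x y)
      (1 + (m * (1 + (n * 6 + 1 + (3 + 2)) + 3) + 1 + (1 + ((n + 1) * 5 + 1 + (2 + (2 + ((n + 2) * 5 + 1)))))))
      (regs [0, 1, m, n, p, q, i0, j0], ns, ws) (?r 0, ns, ?w3 @ replicate (n + 2) 0)"
    unfolding put_bordered_def
  proof (intro runs_seq)
    show "runs inp (instrs [NAdd 6 2 0]) 1 (regs [0, 1, m, n, p, q, i0, j0], ns, ws)
        (regs [0, 1, m, n, p + 0 * n, q + 0, m - 0, ?j 0], ns, ws @ flat 0 ?row)"
      using runs_nat_instr[of "NAdd 6 2 0" inp "regs [0, 1, m, n, p, q, i0, j0]" ns "regs [0, 1, m, n, p, q, m, j0]" ns ws]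
      by (simp add: regs_simps flat_def)
    show "runs inp (for_loop 6 ?body) (m * (1 + (n * 6 + 1 + (3 + 2)) + 3) + 1)
      (regs [0, 1, m, n, p + 0 * n, q + 0, m - 0, ?j 0], ns, ws @ flat 0 ?row) (?r (?j m), ns, ?w1)"
      using loop by simp
    show "runs inp (instrs [NAdd 7 3 1]) 1 (?r (?j m), ns, ?w1) (?r (n + 1), ns, ?w1)"
      by (rule runs_nat_instr) (simp_all add: regs_simps)
    show "runs inp (for_loop 7 (put_const None)) ((n + 1) * 5 + 1) (?r (n + 1), ns, ?w1) (?r 0, ns, ?w2)"
      using runs_put_consts[of "?r (n + 1)" 7 "n + 1" inp None ns ?w1] by (simp add: regs_simps)
    show "runs inp (put_const y) 2 (?r 0, ns, ?w2) (?r 0, ns, ?w3)"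
      using runs_put_const[of inp y "?r 0" ns ?w2] by simp
    show "runs inp (instrs [NAdd 7 3 1, NAdd 7 7 1]) 2 (?r 0, ns, ?w3) (?r (n + 2), ns, ?w3)"
      using runs_nat_instrs[of "[NAdd 7 3 1, NAdd 7 7 1]" inp "?r 0" ns "?r (n + 2)" ns ?w3]
      by (simp add: regs_simps numeral_2_eq_2)
    show "runs inp (for_loop 7 (put_const (Some 0))) ((n + 2) * 5 + 1) (?r (n + 2), ns, ?w3)
        (?r 0, ns, ?w3 @ replicate (n + 2) 0)"
      using runs_put_consts[of "?r (n + 2)" 7 "n + 2" inp "Some 0" ns ?w3] by (simp add: regs_simps zero_ereal_def)
  qed
  then show ?thesis by (simp add: algebra_simps)
qed

lemma runs_game_program:
  fixes u :: "ereal list" and m n :: nat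
  defines "v \<equiv> input_at u"
  defines "block \<equiv> \<lambda>p q x y. flat m (\<lambda>i. map (\<lambda>j. v (p + (i * n + j))) [0..<n] @ [v (q + i), x])
         @ replicate (n + 1) (-\<infinity>) @ [y] @ replicate (n + 2) 0"
  shows "\<exists>\<nu>. runs ([m, n], u) game_program (59 + m * 5 + 2 * (m * (n * 6 + 10) + n * 10)) (\<lambda>_. 0, [], [])
     (\<nu>, [m + 2, n + 2, n], block 0 (2 * (m * n)) (-\<infinity>) 0 @ block (m * n) (2 * (m * n) + m) 0 (-1))"
proof -
  let ?inp = "([m, n], u)"
  let ?B = "m * (n * 6 + 10) + n * 10 + 24"
  let ?ns = "[m + 2, n + 2, n]"
  let ?init = "instrs [NConst 1 1, NRead 2 0, NRead 3 1, NConst 7 2, NAdd 6 2 7, NWrite 6, NAdd 6 3 7, NWrite 6,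
       NWrite 3, NAdd 6 2 0]"
  have "runs ?inp game_program (10 + (m * (2 + 3) + 1 + (?B + ?B))) (\<lambda>_. 0, [], [])
     (regs [0, 1, m, n, 0 + m * n + m * n, 2 * (m * n) + m + m, 0, 0], ?ns,
      block 0 (2 * (m * n)) (-\<infinity>) 0 @ block (m * n) (2 * (m * n) + m) 0 (-1))"
    unfolding game_program_def
  proof (intro runs_seq)
    show "runs ?inp ?init 10 (\<lambda>_. 0, [], []) (regs [0, 1, m, n, 0, 0, m, 2], ?ns, [])"
      using runs_nat_instrs[of "[NConst 1 1, NRead 2 0, NRead 3 1, NConst 7 2, NAdd 6 2 7, NWrite 6, NAdd 6 3 7, NWrite 6,
       NWrite 3, NAdd 6 2 0]" ?inp "\<lambda>_. 0" "[]" "regs [0, 1, m, n, 0, 0, m, 2]" ?ns "[]"]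
      by (simp add: regs_zero[of 8] regs_simps input_at_def numeral_eq_Suc)
    have "runs ?inp (for_loop 6 (instrs [NAdd 5 5 3, NAdd 5 5 3])) (m * (2 + 3) + 1)
       (regs [0, 1, m, n, 0, 2 * (0 * n), m - 0, 2], ?ns, []) (regs [0, 1, m, n, 0, 2 * (m * n), m - m, 2], ?ns, [])"
    proof (rule runs_for_loop[where \<nu> = "\<lambda>i. regs [0, 1, m, n, 0, 2 * (i * n), m - i, 2]"
          and \<nu>' = "\<lambda>i. regs [0, 1, m, n, 0, 2 * (Suc i * n), m - i, 2]"
          and ns = "\<lambda>_. ?ns" and ws = "\<lambda>_. []"])
      show "runs ?inp (instrs [NAdd 5 5 3, NAdd 5 5 3]) 2 (regs [0, 1, m, n, 0, 2 * (i * n), m - i, 2], ?ns, [])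
        (regs [0, 1, m, n, 0, 2 * (Suc i * n), m - i, 2], ?ns, [])" for i
        using runs_nat_instrs[of "[NAdd 5 5 3, NAdd 5 5 3]" ?inp "regs [0, 1, m, n, 0, 2 * (i * n), m - i, 2]" ?ns
          "regs [0, 1, m, n, 0, 2 * (Suc i * n), m - i, 2]" ?ns "[]"]
        by (simp add: regs_simps algebra_simps numeral_2_eq_2)
    qed (auto simp: regs_simps)
    then show "runs ?inp (for_loop 6 (instrs [NAdd 5 5 3, NAdd 5 5 3])) (m * (2 + 3) + 1)
       (regs [0, 1, m, n, 0, 0, m, 2], ?ns, []) (regs [0, 1, m, n, 0, 2 * (m * n), 0, 2], ?ns, [])" by simp
    show "runs ?inp (put_bordered None (Some 0)) ?B (regs [0, 1, m, n, 0, 2 * (m * n), 0, 2], ?ns, [])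
        (regs [0, 1, m, n, 0 + m * n, 2 * (m * n) + m, 0, 0], ?ns, block 0 (2 * (m * n)) (-\<infinity>) 0)"
      using runs_put_bordered[of ?inp None "Some 0" m n 0 "2 * (m * n)" 0 2 ?ns "[]"]
      by (simp add: block_def v_def zero_ereal_def)
    show "runs ?inp (put_bordered (Some 0) (Some (-1))) ?B
        (regs [0, 1, m, n, 0 + m * n, 2 * (m * n) + m, 0, 0], ?ns, block 0 (2 * (m * n)) (-\<infinity>) 0)
        (regs [0, 1, m, n, 0 + m * n + m * n, 2 * (m * n) + m + m, 0, 0], ?ns,
          block 0 (2 * (m * n)) (-\<infinity>) 0 @ block (m * n) (2 * (m * n) + m) 0 (-1))"
      using runs_put_bordered[of ?inp "Some 0" "Some (-1)" m n "0 + m * n" "2 * (m * n) + m" 0 0 ?ns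
          "block 0 (2 * (m * n)) (-\<infinity>) 0"]
      by (simp add: block_def v_def zero_ereal_def one_ereal_def of_rat_minus)
  qed
  moreover have "10 + (m * (2 + 3) + 1 + (?B + ?B)) = 59 + m * 5 + 2 * (m * (n * 6 + 10) + n * 10)" by simp
  ultimately show ?thesis by metis
qed

lemma runs_polyhedron_program:
  fixes u :: "ereal list" and m n r :: nat
  assumes r: "r < n"
  defines "v \<equiv> input_at u"
  defines "block \<equiv> \<lambda>p. flat m (\<lambda>i. map (\<lambda>j. v (p + (i * n + j))) [0..<n])"
  shows "\<exists>\<nu>. runs ([m, n, r], u) polyhedron_program (27 + 2 * (m * (n * 6 + 5)) + m * 10 + n * 10) (\<lambda>_. 0, [], [])
     (\<nu>, [m + 1, n], block 0 @ replicate n (-\<infinity>) @ block (m * n) @ replicate r (-\<infinity>) @ [0] @ replicate (n - r - 1) (-\<infinity>)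
        @ replicate m (-\<infinity>) @ [0] @ replicate (m + 1) (-\<infinity>))"
proof -
  let ?inp = "([m, n, r], u)"
  let ?ns = "[m + 1, n]"
  let ?M = "2 + m * (n * 6 + 5)"
  let ?j = "\<lambda>j. if m = 0 then j else (0::nat)"
  let ?r = "\<lambda>p j. regs [0, 1, m, n, p, r, 0, j]"
  let ?init = "[NConst 1 1, NRead 2 0, NRead 3 1, NAdd 6 1 1, NRead 5 6, NAdd 6 2 1, NWrite 6, NWrite 3]"
  let ?w1 = "block 0"
  let ?w2 = "?w1 @ replicate n (-\<infinity>)"
  let ?w3 = "?w2 @ block (m * n)"
  let ?w4 = "?w3 @ replicate r (-\<infinity>)"
  let ?w5 = "?w4 @ [0]"
  let ?w6 = "?w5 @ replicate (n - r - 1) (-\<infinity>)"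
  let ?w7 = "?w6 @ replicate m (-\<infinity>)"
  let ?w8 = "?w7 @ [0]"
  let ?w9 = "?w8 @ replicate (m + 1) (-\<infinity>)"
  have infs: "runs ?inp (for_loop 7 (put_const None)) (k * 5 + 1) (?r p k, ?ns, ws) (?r p 0, ?ns, ws @ replicate k (-\<infinity>))" for p k ws
    using runs_put_consts[of "?r p k" 7 k ?inp None ?ns ws] by (simp add: regs_simps)
  have zero: "runs ?inp (put_const (Some 0)) 2 (?r p 0, ?ns, ws) (?r p 0, ?ns, ws @ [0])" for p ws
    using runs_put_const[of ?inp "Some 0" "?r p 0" ?ns ws] by (simp add: zero_ereal_def)
  have "runs ?inp polyhedron_program
     (8 + (?M + (1 + (n * 5 + 1 + (?M + (1 + (r * 5 + 1 + (2 + (2 + ((n - r - 1) * 5 + 1 +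
       (1 + (m * 5 + 1 + (2 + (1 + ((m + 1) * 5 + 1))))))))))))))) (\<lambda>_. 0, [], [])
     (?r (0 + m * n + m * n) 0, ?ns, ?w9)"
    unfolding polyhedron_program_def
  proof (intro runs_seq)
    show "runs ?inp (instrs ?init) 8 (\<lambda>_. 0, [], []) (regs [0, 1, m, n, 0, r, m + 1, 0], ?ns, [])"
      using runs_nat_instrs[of ?init ?inp "\<lambda>_. 0" "[]" "regs [0, 1, m, n, 0, r, m + 1, 0]" ?ns "[]"]
      by (simp add: regs_zero[of 8] regs_simps input_at_def numeral_eq_Suc)
    show "runs ?inp put_matrix ?M (regs [0, 1, m, n, 0, r, m + 1, 0], ?ns, []) (?r (0 + m * n) (?j 0), ?ns, ?w1)"
      using runs_put_matrix[of ?inp m n 0 r "m + 1" 0 ?ns "[]"] by (simp add: block_def v_def)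
    show "runs ?inp (instrs [NAdd 7 3 0]) 1 (?r (0 + m * n) (?j 0), ?ns, ?w1) (?r (0 + m * n) n, ?ns, ?w1)"
      by (rule runs_nat_instr) (simp_all add: regs_simps)
    show "runs ?inp (for_loop 7 (put_const None)) (n * 5 + 1) (?r (0 + m * n) n, ?ns, ?w1) (?r (0 + m * n) 0, ?ns, ?w2)"
      by (rule infs)
    show "runs ?inp put_matrix ?M (?r (0 + m * n) 0, ?ns, ?w2) (?r (0 + m * n + m * n) (?j 0), ?ns, ?w3)"
      using runs_put_matrix[of ?inp m n "0 + m * n" r 0 0 ?ns ?w2] by (simp add: block_def v_def)
    let ?p = "0 + m * n + m * n"
    show "runs ?inp (instrs [NAdd 7 5 0]) 1 (?r ?p (?j 0), ?ns, ?w3) (?r ?p r, ?ns, ?w3)"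
      by (rule runs_nat_instr) (simp_all add: regs_simps)
    show "runs ?inp (for_loop 7 (put_const None)) (r * 5 + 1) (?r ?p r, ?ns, ?w3) (?r ?p 0, ?ns, ?w4)"
      by (rule infs)
    show "runs ?inp (put_const (Some 0)) 2 (?r ?p 0, ?ns, ?w4) (?r ?p 0, ?ns, ?w5)"
      by (rule zero)
    show "runs ?inp (instrs [NSub 7 3 5, NSub 7 7 1]) 2 (?r ?p 0, ?ns, ?w5) (?r ?p (n - r - 1), ?ns, ?w5)"
      using runs_nat_instrs[of "[NSub 7 3 5, NSub 7 7 1]" ?inp "?r ?p 0" ?ns "?r ?p (n - r - 1)" ?ns ?w5]
      by (simp add: regs_simps numeral_2_eq_2)
    show "runs ?inp (for_loop 7 (put_const None)) ((n - r - 1) * 5 + 1) (?r ?p (n - r - 1), ?ns, ?w5) (?r ?p 0, ?ns, ?w6)"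
      by (rule infs)
    show "runs ?inp (instrs [NAdd 7 2 0]) 1 (?r ?p 0, ?ns, ?w6) (?r ?p m, ?ns, ?w6)"
      by (rule runs_nat_instr) (simp_all add: regs_simps)
    show "runs ?inp (for_loop 7 (put_const None)) (m * 5 + 1) (?r ?p m, ?ns, ?w6) (?r ?p 0, ?ns, ?w7)"
      by (rule infs)
    show "runs ?inp (put_const (Some 0)) 2 (?r ?p 0, ?ns, ?w7) (?r ?p 0, ?ns, ?w8)"
      by (rule zero)
    show "runs ?inp (instrs [NAdd 7 2 1]) 1 (?r ?p 0, ?ns, ?w8) (?r ?p (m + 1), ?ns, ?w8)"
      by (rule runs_nat_instr) (simp_all add: regs_simps)
    show "runs ?inp (for_loop 7 (put_const None)) ((m + 1) * 5 + 1) (?r ?p (m + 1), ?ns, ?w8) (?r ?p 0, ?ns, ?w9)"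
      by (rule infs)
  qed
  moreover have "8 + (?M + (1 + (n * 5 + 1 + (?M + (1 + (r * 5 + 1 + (2 + (2 + ((n - r - 1) * 5 + 1 +
       (1 + (m * 5 + 1 + (2 + (1 + ((m + 1) * 5 + 1)))))))))))))) = 27 + 2 * (m * (n * 6 + 5)) + m * 10 + n * 10"
    using r by simp
  ultimately show ?thesis by (simp only: append_assoc) blast
qed

section \<open>Linear time\<close>

text \<open>
  The running time is dominated by \<open>m * n\<close>: as neither dimension is 0, each of them is at most \<open>m * n\<close>,
  and \<open>m * n\<close> is at most half of the size of the input.
\<close>

lemma polyhedron_emptiness_to_mean_payoff:
  "linear_time_transformable polyhedron_emptiness (complement mean_payoff_winning)"
  unfolding linear_time_transformable_def
proof (intro exI ballI)
  let ?P = polyhedron_emptiness and ?Q = "complement mean_payoff_winning"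
  fix I assume I: "I \<in> instances ?P"
  then obtain A B c d m n where I_eq: "I = (A, B, c, d)" and mn: "0 < m" "0 < n"
    and A: "A \<in> trop_mat m n" and B: "B \<in> trop_mat m n" and c: "c \<in> trop_vec m" and d: "d \<in> trop_vec m"
    by (auto simp: polyhedron_emptiness_def)
  have dim: "dim_row A = m" "dim_col A = n" "dim_row B = m" "dim_col B = n" "dim_vec c = m" "dim_vec d = m"
    using A B c d by (auto simp: trop_mat_def trop_vec_def)
  let ?a = "concat (mat_to_list A)" and ?b = "concat (mat_to_list B)"
  let ?u = "?a @ ?b @ list_of_vec c @ list_of_vec d"
  let ?time = "59 + m * 5 + 2 * (m * (n * 6 + 10) + n * 10)"
  have len: "length ?a = m * n" "length ?b = m * n" by (simp_all add: length_mat_to_list dim)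
  have enc: "encoding ?P I = ([m, n], ?u)" by (simp add: polyhedron_emptiness_def I_eq dim)
  have readA: "input_at ?u (0 + (i * n + j)) = A $$ (i, j)" if "i < m" "j < n" for i j
    using input_at_matrix[of i A j "[]" 0] that dim by simp
  have readB: "input_at ?u (m * n + (i * n + j)) = B $$ (i, j)" if "i < m" "j < n" for i j
    using input_at_matrix[of i B j ?a "m * n"] that by (simp add: dim len)
  have readc: "input_at ?u (2 * (m * n) + i) = c $ i" if "i < m" for i
    using input_at_vector[of i c "?a @ ?b" "2 * (m * n)"] that by (simp add: dim len)
  have readd: "input_at ?u (2 * (m * n) + m + i) = d $ i" if "i < m" for i
    using input_at_vector[of i d "?a @ ?b @ list_of_vec c" "2 * (m * n) + m" "[]"] that by (simp add: dim len)
  have outA: "flat m (\<lambda>i. map (\<lambda>j. input_at ?u (0 + (i * n + j))) [0..<n] @ [input_at ?u (2 * (m * n) + i), -\<infinity>])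
      @ replicate (n + 1) (-\<infinity>) @ [0] @ replicate (n + 2) 0 = concat (mat_to_list (bordered A c (-\<infinity>) 0))"
    unfolding flat_bordered dim
    by (intro arg_cong2[where f = append] refl flat_cong) (use readA readc in \<open>auto intro!: map_cong\<close>)
  have outB: "flat m (\<lambda>i. map (\<lambda>j. input_at ?u (m * n + (i * n + j))) [0..<n] @ [input_at ?u (2 * (m * n) + m + i), 0])
      @ replicate (n + 1) (-\<infinity>) @ [-1] @ replicate (n + 2) 0 = concat (mat_to_list (bordered B d 0 (-1)))"
    unfolding flat_bordered dim
    by (intro arg_cong2[where f = append] refl flat_cong) (use readB readd in \<open>auto intro!: map_cong\<close>)
  have enc': "encoding ?Q (game_of_polyhedron I) =
      ([m + 2, n + 2, n], concat (mat_to_list (bordered A c (-\<infinity>) 0)) @ concat (mat_to_list (bordered B d 0 (-1))))"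
    by (simp add: complement_def mean_payoff_winning_def game_of_polyhedron_def I_eq dim)
  have "n \<le> m * n" using mn by simp
  moreover have "?time = 59 + 25 * m + 12 * (m * n) + 20 * n" by (simp add: algebra_simps)
  moreover have "data_size (encoding ?P I) = 2 + 2 * (m * n) + 2 * m" by (simp add: enc data_size_def len dim)
  ultimately have time: "?time \<le> 30 * data_size (encoding ?P I)" by linarith
  obtain \<nu> where run: "runs ([m, n], ?u) game_program ?time (\<lambda>_. 0, [], []) (\<nu>, encoding ?Q (game_of_polyhedron I))"
    using runs_game_program[of m n ?u] unfolding outA outB enc' by blast
  show "\<exists>J\<in>instances ?Q.
      computes_within (game_program 0) (encoding ?P I) (30 * data_size (encoding ?P I)) (encoding ?Q J) \<and>
      (yes ?P I \<longleftrightarrow> yes ?Q J)"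
  proof (intro bexI conjI)
    show "game_of_polyhedron I \<in> instances ?Q"
      using game_of_polyhedron_correct(1)[OF I] by (simp add: complement_def)
    show "computes_within (game_program 0) (encoding ?P I) (30 * data_size (encoding ?P I))
        (encoding ?Q (game_of_polyhedron I))"
      using runs_computes_within[OF run time] by (simp only: enc)
    show "yes ?P I \<longleftrightarrow> yes ?Q (game_of_polyhedron I)"
      using game_of_polyhedron_correct(2)[OF I]
      by (auto simp: complement_def polyhedron_emptiness_def mean_payoff_winning_def)
  qed
qed

lemma mean_payoff_to_polyhedron_emptiness:
  "linear_time_transformable mean_payoff_winning (complement polyhedron_emptiness)"
  unfolding linear_time_transformable_def
proof (intro exI ballI)
  let ?P = mean_payoff_winning and ?Q = "complement polyhedron_emptiness"
  fix I assume I: "I \<in> instances ?P"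
  then obtain A B r m n where I_eq: "I = (A, B, r)" and mn: "0 < m" "0 < n" and r: "r < n"
    and A: "A \<in> trop_mat m n" and B: "B \<in> trop_mat m n"
    by (auto simp: mean_payoff_winning_def)
  have dim: "dim_row A = m" "dim_col A = n" "dim_row B = m" "dim_col B = n"
    using A B by (auto simp: trop_mat_def)
  let ?a = "concat (mat_to_list A)" and ?b = "concat (mat_to_list B)"
  let ?u = "?a @ ?b"
  let ?time = "27 + 2 * (m * (n * 6 + 5)) + m * 10 + n * 10"
  have len: "length ?a = m * n" "length ?b = m * n" by (simp_all add: length_mat_to_list dim)
  have enc: "encoding ?P I = ([m, n, r], ?u)" by (simp add: mean_payoff_winning_def I_eq dim)
  have readA: "input_at ?u (0 + (i * n + j)) = A $$ (i, j)" if "i < m" "j < n" for i j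
    using input_at_matrix[of i A j "[]" 0] that dim by simp
  have readB: "input_at ?u (m * n + (i * n + j)) = B $$ (i, j)" if "i < m" "j < n" for i j
    using input_at_matrix[of i B j ?a "m * n" "[]"] that by (simp add: dim len)
  let ?A = "mat (Suc m) n (\<lambda>(i, j). if i < m then A $$ (i, j) else -\<infinity>)"
  let ?B = "mat (Suc m) n (\<lambda>(i, j). if i < m then B $$ (i, j) else if j = r then 0 else -\<infinity>)"
  have J_eq: "polyhedron_of_game I = (?A, ?B, vec (Suc m) (\<lambda>i. if i < m then -\<infinity> else 0), vec (Suc m) (\<lambda>_. -\<infinity>))"
    by (simp add: polyhedron_of_game_def I_eq dim)
  have outA: "concat (mat_to_list ?A) =
      flat m (\<lambda>i. map (\<lambda>j. input_at ?u (0 + (i * n + j))) [0..<n]) @ replicate n (-\<infinity>)"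
  proof -
    have "map (\<lambda>j. ?A $$ (m, j)) [0..<n] = map (\<lambda>_. -\<infinity>) [0..<n]" by (rule map_cong) auto
    then have last: "map (\<lambda>j. ?A $$ (m, j)) [0..<n] = replicate n (-\<infinity>)" by (simp add: map_replicate_const)
    have "flat m (\<lambda>i. map (\<lambda>j. ?A $$ (i, j)) [0..<n]) = flat m (\<lambda>i. map (\<lambda>j. input_at ?u (0 + (i * n + j))) [0..<n])"
      by (intro flat_cong map_cong refl) (use readA in auto)
    then show ?thesis unfolding mat_flat dim_row_mat dim_col_mat flat_Suc last by (simp only:)
  qed
  have outB: "concat (mat_to_list ?B) =
      flat m (\<lambda>i. map (\<lambda>j. input_at ?u (m * n + (i * n + j))) [0..<n]) @
      replicate r (-\<infinity>) @ [0] @ replicate (n - r - 1) (-\<infinity>)"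
  proof -
    have last: "map (\<lambda>j. ?B $$ (m, j)) [0..<n] = replicate r (-\<infinity>) @ [0] @ replicate (n - r - 1) (-\<infinity>)"
      by (rule nth_equalityI) (use r in \<open>auto simp: nth_append nth_Cons'\<close>)
    have "flat m (\<lambda>i. map (\<lambda>j. ?B $$ (i, j)) [0..<n]) = flat m (\<lambda>i. map (\<lambda>j. input_at ?u (m * n + (i * n + j))) [0..<n])"
      by (intro flat_cong map_cong refl) (use readB in auto)
    then show ?thesis unfolding mat_flat dim_row_mat dim_col_mat flat_Suc last by (simp only:)
  qed
  have outc: "list_of_vec (vec (Suc m) (\<lambda>i. if i < m then -\<infinity> else 0 :: ereal)) = replicate m (-\<infinity>) @ [0]"
    by (rule nth_equalityI) (auto simp: nth_append)
  have outd: "list_of_vec (vec (Suc m) (\<lambda>_. -\<infinity> :: ereal)) = replicate (m + 1) (-\<infinity>)"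
    by (simp only: list_of_vec_vec map_replicate_const length_upt) simp
  have enc': "encoding ?Q (polyhedron_of_game I) = ([m + 1, n], 
      flat m (\<lambda>i. map (\<lambda>j. input_at ?u (0 + (i * n + j))) [0..<n]) @ replicate n (-\<infinity>) @
      flat m (\<lambda>i. map (\<lambda>j. input_at ?u (m * n + (i * n + j))) [0..<n]) @
      replicate r (-\<infinity>) @ [0] @ replicate (n - r - 1) (-\<infinity>) @
      replicate m (-\<infinity>) @ [0] @ replicate (m + 1) (-\<infinity>))"
    unfolding J_eq complement_def polyhedron_emptiness_def
    by (simp add: outA outB outc outd del: list_of_vec_vec replicate.simps)
  have "m \<le> m * n" "n \<le> m * n" using mn by simp_all
  moreover have "?time = 27 + 20 * m + 12 * (m * n) + 10 * n" by (simp add: algebra_simps)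
  moreover have "data_size (encoding ?P I) = 3 + 2 * (m * n)" by (simp add: enc data_size_def len dim)
  ultimately have time: "?time \<le> 30 * data_size (encoding ?P I)" by linarith
  obtain \<nu> where run: "runs ([m, n, r], ?u) polyhedron_program ?time (\<lambda>_. 0, [], [])
      (\<nu>, encoding ?Q (polyhedron_of_game I))"
    using runs_polyhedron_program[OF r, of m ?u] unfolding enc' by blast
  show "\<exists>J\<in>instances ?Q.
      computes_within (polyhedron_program 0) (encoding ?P I) (30 * data_size (encoding ?P I)) (encoding ?Q J) \<and>
      (yes ?P I \<longleftrightarrow> yes ?Q J)"
  proof (intro bexI conjI)
    show "polyhedron_of_game I \<in> instances ?Q"
      using polyhedron_of_game_correct(1)[OF I] by (simp add: complement_def)
    show "computes_within (polyhedron_program 0) (encoding ?P I) (30 * data_size (encoding ?P I))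
        (encoding ?Q (polyhedron_of_game I))"
      using runs_computes_within[OF run time] by (simp only: enc)
    show "yes ?P I \<longleftrightarrow> yes ?Q (polyhedron_of_game I)"
      using polyhedron_of_game_correct(2)[OF I]
      by (auto simp: complement_def polyhedron_emptiness_def mean_payoff_winning_def)
  qed
qed

theorem corollary3p7:
  shows "linear_time_transformable polyhedron_emptiness (complement mean_payoff_winning) \<and>
         linear_time_transformable mean_payoff_winning (complement polyhedron_emptiness)"
  using polyhedron_emptiness_to_mean_payoff mean_payoff_to_polyhedron_emptiness by blast

end
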